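(* Fix $\epsilon$ with $0<\epsilon<1/2$. There is a constant $c>0$ (depending only on $\epsilon$) such that the following hold for all sufficiently large $N$ and all $M\ge N$ (in particular for $M=N$). (1) If $N$ is even, every quantum query algorithm that computes the collision property of functions $f:[N]\to[M]$ with error $\epsilon$ uses at least $cN^{1/3}$ queries. (2) Every quantum query algorithm that computes the element distinctness property of functions $f:[N]\to[M]$ with error $\epsilon$ uses at least $cN^{2/3}$ queries.
   Context: $[k]=\{1,\dots,k\}$, and $\mathcal{F}(N,M)$ is the set of all functions $f:[N]\to[M]$. Collision property: the partial function $\phi$ on $\mathcal{F}(N,M)$ with $\phi(f)=1$ if $f$ is one-to-one; $\phi(f)=0$ if $f$ is two-to-one, i.e. for every $k\in[M]$ there are either zero or two $x\in[N]$ with $f(x)=k$; and $\phi(f)$ undefined otherwise. Element distinctness property: the total function $\phi$ on $\mathcal{F}(N,M)$ with $\phi(f)=1$ if $f$ is one-to-one, and $\phi(f)=0$ if there exist $i\ne j$ with $f(i)=f(j)$. Quantum query algorithm: the state space is a finite-dimensional complex Hilbert space with orthonormal basis $|i,b,z\rangle$, where $i\in[N]$, $b\in\{0,\dots,M-1\}$, and $z$ ranges over bit strings of some fixed positive length (of arbitrary size). For $f\in\mathcal{F}(N,M)$ the query transformation $O_f$ is the unitary $|i,b,z\rangle\mapsto|i,(b+f(i))\bmod M,z\rangle$. An algorithm with $T$ queries is a sequence of unitary transformations $U_0,\dots,U_T$ not depending on $f$; starting from a fixed basis state $|0\rangle$, the final state is $U_TO_fU_{T-1}O_f\cdots U_1O_fU_0|0\rangle$,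 which is measured in the basis above, and the output is the rightmost bit (the last bit of $z$) of the result. The algorithm computes $\phi$ with error $\epsilon$ if, for every $f\in\mathcal{F}(N,M)$ such that $\phi(f)$ is defined, the output equals $\phi(f)$ with probability at least $1-\epsilon$. *)

theory Defs
  imports Complex_Main "HOL-Library.FuncSet"
begin

definition function_space :: "nat \<Rightarrow> nat \<Rightarrow> (nat \<Rightarrow> nat) set" where
  "function_space N M = {1..N} \<rightarrow>\<^sub>E {1..M}"

text \<open>A partial Boolean property is a map into \<^typ>\<open>bool option\<close>: \<^term>\<open>None\<close> means
  undefined, and \<^term>\<open>True\<close>, \<^term>\<open>False\<close> stand for 1, 0.\<close>

definition collision :: "nat \<Rightarrow> nat \<Rightarrow> (nat \<Rightarrow> nat) \<Rightarrow> bool option" where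
  "collision N M f =
     (if inj_on f {1..N} then Some True
      else if \<forall>k\<in>{1..M}. card {x \<in> {1..N}. f x = k} \<in> {0, 2} then Some False
      else None)"

definition element_distinctness :: "nat \<Rightarrow> (nat \<Rightarrow> nat) \<Rightarrow> bool option" where
  "element_distinctness N f =
     (if \<exists>i\<in>{1..N}. \<exists>j\<in>{1..N}. i \<noteq> j \<and> f i = f j then Some False else Some True)"

type_synonym label = "nat \<times> nat \<times> bool list"

definition basis :: "nat \<Rightarrow> nat \<Rightarrow> nat \<Rightarrow> label set" where
  "basis N M m = {1..N} \<times> {0..<M} \<times> {z. length z = m}"

text \<open>Vectors and operators on the Hilbert space with finite orthonormal basis \<open>B\<close> are given by
  their coordinates and matrix entries. Only the values at labels in \<open>B\<close> are ever used.\<close>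

type_synonym state = "label \<Rightarrow> complex"
type_synonym operator = "label \<Rightarrow> label \<Rightarrow> complex"

definition ket :: "label \<Rightarrow> state" where
  "ket s = (\<lambda>x. if x = s then 1 else 0)"

definition op_apply :: "label set \<Rightarrow> operator \<Rightarrow> state \<Rightarrow> state" where
  "op_apply B A v = (\<lambda>x. \<Sum>y\<in>B. A x y * v y)"

definition unitary_on :: "label set \<Rightarrow> operator \<Rightarrow> bool" where
  "unitary_on B U \<longleftrightarrow>
     (\<forall>x\<in>B. \<forall>y\<in>B. (\<Sum>z\<in>B. cnj (U z x) * U z y) = (if x = y then 1 else 0)) \<and>
     (\<forall>x\<in>B. \<forall>y\<in>B. (\<Sum>z\<in>B. U x z * cnj (U y z)) = (if x = y then 1 else 0))"

fun query_label :: "nat \<Rightarrow> (nat \<Rightarrow> nat) \<Rightarrow> label \<Rightarrow> label" where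
  "query_label M f (i, b, z) = (i, (b + f i) mod M, z)"

definition query_op :: "nat \<Rightarrow> (nat \<Rightarrow> nat) \<Rightarrow> operator" where
  "query_op M f = (\<lambda>x y. ket (query_label M f y) x)"

record query_algorithm =
  workspace :: nat
  queries :: nat
  start :: label
  gate :: "nat \<Rightarrow> operator"

text \<open>The start label is arbitrary, so lower bounds hold for every choice of the fixed basis
  state written \<open>|0\<rangle>\<close>. The gates beyond index \<^term>\<open>queries A\<close> are irrelevant.\<close>

definition valid_algorithm :: "nat \<Rightarrow> nat \<Rightarrow> query_algorithm \<Rightarrow> bool" where
  "valid_algorithm N M A \<longleftrightarrow>
     workspace A > 0 \<and>
     start A \<in> basis N M (workspace A) \<and>
     (\<forall>t\<le>queries A. unitary_on (basis N M (workspace A)) (gate A t))"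

fun state_after :: "nat \<Rightarrow> nat \<Rightarrow> query_algorithm \<Rightarrow> (nat \<Rightarrow> nat) \<Rightarrow> nat \<Rightarrow> state" where
  "state_after N M A f 0 = op_apply (basis N M (workspace A)) (gate A 0) (ket (start A))"
| "state_after N M A f (Suc t) =
     op_apply (basis N M (workspace A)) (gate A (Suc t))
       (op_apply (basis N M (workspace A)) (query_op M f) (state_after N M A f t))"

definition final_state :: "nat \<Rightarrow> nat \<Rightarrow> query_algorithm \<Rightarrow> (nat \<Rightarrow> nat) \<Rightarrow> state" where
  "final_state N M A f = state_after N M A f (queries A)"

definition output_prob :: "nat \<Rightarrow> nat \<Rightarrow> query_algorithm \<Rightarrow> (nat \<Rightarrow> nat) \<Rightarrow> bool \<Rightarrow> real" where
  "output_prob N M A f v =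
     (\<Sum>(i, b, z) \<in> {(i, b, z) \<in> basis N M (workspace A). last z = v}.
        (cmod (final_state N M A f (i, b, z)))\<^sup>2)"

definition computes ::
  "nat \<Rightarrow> nat \<Rightarrow> query_algorithm \<Rightarrow> ((nat \<Rightarrow> nat) \<Rightarrow> bool option) \<Rightarrow> real \<Rightarrow> bool" where
  "computes N M A \<phi> \<epsilon> \<longleftrightarrow>
     (\<forall>f\<in>function_space N M. \<forall>v. \<phi> f = Some v \<longrightarrow> output_prob N M A f v \<ge> 1 - \<epsilon>)"

end

theory Submission
  imports Defs "HOL-Computational_Algebra.Polynomial" "HOL-Combinatorics.Permutations"
begin

text \<open>The acceptance probability after \<open>T\<close> queries is a polynomial of degree at most \<open>2T\<close> in the
  indicators \<open>[f i = j]\<close>. Fix a colouring \<open>h\<close> of \<open>V \<ge> N\<close> points, of which \<open>m\<close> lie in colour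
  classes of size \<open>a\<close> and the others in classes of size \<open>b\<close>, and average over inputs \<open>f\<close> that restrict
  \<open>h\<close> to \<open>N\<close> random points and rename the colours that occur by random elements of the range. Only the
  colours that occur have to be renamed, so a range of size \<open>N\<close> is enough however many colours \<open>h\<close> has.
  The average of a monomial is the probability of a coincidence pattern among at most \<open>2T\<close> points, so for
  fixed \<open>b\<close> the averages are values \<open>R m a\<close> of a function that is a polynomial of degree at most \<open>2T\<close> in
  \<open>m\<close> and in \<open>a\<close>.

  Between the classes of type \<open>(1,1)\<close>, \<open>(1,2)\<close> and \<open>(2,2)\<close>, with \<open>m\<close> near \<open>V/2\<close>, the average has to jump,
  so for some \<open>b \<in> {1, 2}\<close> there is a gap between \<open>a = 1\<close> and \<open>a = 2\<close>. A polynomial bounded on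
  \<open>0, ..., k\<close> with such a gap has degree of order \<open>sqrt k\<close>, hence \<open>R m a\<close> is large for some integer
  \<open>a = k\<close> of order \<open>T^2\<close>. But the average is a probability whenever \<open>m\<close> is a multiple of \<open>2k\<close>, and
  a polynomial that is bounded at equally spaced points and large in the middle between them has degree of the
  order of the number of points, here \<open>V/k\<close>. Hence \<open>V = O(T^3)\<close>. Take \<open>V = N\<close> for the collision
  property and \<open>V\<close> of order \<open>N^2\<close> for element distinctness: by the birthday paradox a random
  \<open>N\<close>-subset of a two-to-one colouring then contains a collision with probability close to one.\<close>

section \<open>Query algorithms and polynomials\<close>

text \<open>\<open>S\<close> may demand two values at one index and then gives zero, so products of
  monomials are unions without any case distinction.\<close>

definition monomial :: "(nat \<times> nat) set \<Rightarrow> (nat \<Rightarrow> nat) \<Rightarrow> complex" where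
  "monomial S f = (if \<forall>(i, j)\<in>S. f i = j then 1 else 0)"

text \<open>The degree of a term is its number of index-value pairs. The inductive form lets linear
  operations such as averaging be treated one monomial at a time.\<close>

inductive query_poly :: "nat \<Rightarrow> nat \<Rightarrow> nat \<Rightarrow> ((nat \<Rightarrow> nat) \<Rightarrow> complex) \<Rightarrow> bool"
  for n M d where
  monom: "S \<subseteq> {1..n} \<times> {1..M} \<Longrightarrow> card S \<le> d \<Longrightarrow> query_poly n M d (\<lambda>f. c * monomial S f)"
| add: "query_poly n M d F \<Longrightarrow> query_poly n M d G \<Longrightarrow> query_poly n M d (\<lambda>f. F f + G f)"

lemma query_poly_const: "query_poly n M d (\<lambda>f. c)"
  using query_poly.monom[of "{}" n M d c] by (simp add: monomial_def)

lemma query_poly_sum: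
  assumes "\<And>x. x \<in> A \<Longrightarrow> query_poly n M d (F x)"
  shows "query_poly n M d (\<lambda>f. \<Sum>x\<in>A. F x f)"
  using assms
  by (induction A rule: infinite_finite_induct) (simp_all add: query_poly_const query_poly.add)

lemma monomial_mult: "monomial S f * monomial T f = monomial (S \<union> T) f"
  by (auto simp: monomial_def)

lemma query_poly_mult:
  assumes "query_poly n M d F" "query_poly n M e G"
  shows "query_poly n M (d + e) (\<lambda>f. F f * G f)"
  using assms(1)
proof induction
  case (monom S c)
  show ?case using assms(2)
  proof induction
    case inner: (monom T c')
    have "card (S \<union> T) \<le> d + e" using card_Un_le[of S T] monom inner by linarith
    then have "query_poly n M (d + e) (\<lambda>f. (c * c') * monomial (S \<union> T) f)"
      using monom inner by (intro query_poly.monom) auto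
    then show ?case by (simp add: monomial_mult[symmetric] ac_simps)
  next
    case inner: (add F G)
    then show ?case using query_poly.add by (simp add: distrib_left)
  qed
next
  case (add F G)
  then show ?case using query_poly.add by (simp add: distrib_right)
qed

lemma query_poly_cmult: "query_poly n M d F \<Longrightarrow> query_poly n M d (\<lambda>f. c * F f)"
  using query_poly_mult[OF query_poly_const[of n M 0 c]] by simp

lemma query_poly_cnj: "query_poly n M d F \<Longrightarrow> query_poly n M d (\<lambda>f. cnj (F f))"
proof (induction rule: query_poly.induct)
  case (monom S c)
  then show ?case using query_poly.monom[of S n M d "cnj c"] by (simp add: monomial_def if_distrib cong: if_cong)
next
  case (add F G)
  then show ?case using query_poly.add by simp
qed

lemma finite_basis: "finite (basis N M m)"
proof -
  have "finite {z :: bool list. length z = m}" using finite_lists_length_eq[of "UNIV :: bool set"] by simp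
  then show ?thesis by (simp add: basis_def)
qed

text \<open>The column at \<open>w\<close> depends on \<open>f\<close> only through its value at the
  index stored in \<open>w\<close>. Splitting by that value gives entries of degree one.\<close>

lemma query_op_expand:
  assumes "f \<in> function_space N M" "w \<in> basis N M m"
  shows "query_op M f y w =
    (\<Sum>j\<in>{1..M}. (if y = (fst w, (fst (snd w) + j) mod M, snd (snd w)) then 1 else 0) * monomial {(fst w, j)} f)"
proof -
  obtain i b z where w: "w = (i, b, z)" by (cases w)
  have "f i \<in> {1..M}" using assms by (auto simp: w basis_def function_space_def)
  have "(\<Sum>j\<in>{1..M}. (if y = (i, (b + j) mod M, z) then 1 else 0) * monomial {(i, j)} f) =
      (\<Sum>j\<in>{1..M}. if f i = j then (if y = (i, (b + f i) mod M, z) then 1 else 0) else 0)"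
    by (intro sum.cong) (auto simp: monomial_def)
  also have "\<dots> = (if y = (i, (b + f i) mod M, z) then 1 else 0)"
    using \<open>f i \<in> {1..M}\<close> by simp
  finally show ?thesis by (simp add: w query_op_def ket_def)
qed

text \<open>Gates are linear with coefficients independent of \<open>f\<close>, so only queries
  raise the degree, each by one.\<close>

lemma state_after_query_poly:
  "\<exists>F. query_poly N M t F \<and> (\<forall>f\<in>function_space N M. state_after N M A f t x = F f)"
proof (induction t arbitrary: x)
  case 0
  show ?case using query_poly_const by (intro exI conjI) auto
next
  case (Suc t)
  let ?B = "basis N M (workspace A)"
  from Suc obtain F where F: "\<And>w. query_poly N M t (F w)"
    "\<And>w f. f \<in> function_space N M \<Longrightarrow> state_after N M A f t w = F w f"
    by metis
  define G where "G f = (\<Sum>y\<in>?B. gate A (Suc t) x y * (\<Sum>w\<in>?B. (\<Sum>j\<in>{1..M}.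
      (if y = (fst w, (fst (snd w) + j) mod M, snd (snd w)) then 1 else 0) * monomial {(fst w, j)} f) * F w f))" for f
  have "query_poly N M (1 + t) G"
    unfolding G_def
  proof (intro query_poly_sum query_poly_cmult query_poly_mult F)
    fix y w j assume "w \<in> ?B" "j \<in> {1..M}"
    then show "query_poly N M 1 (monomial {(fst w, j)})"
      using query_poly.monom[of "{(fst w, j)}" N M 1 1] by (auto simp: basis_def)
  qed
  moreover have "state_after N M A f (Suc t) x = G f" if f: "f \<in> function_space N M" for f
    by (simp add: G_def op_apply_def F(2)[OF f] query_op_expand[OF f] cong: sum.cong)
  ultimately show ?case by (intro exI[of _ G]) simp
qed

text \<open>A squared modulus is an amplitude times its conjugate, and conjugation changes only
  coefficients because the monomials are real. Hence the doubled degree.\<close>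

lemma output_prob_query_poly:
  "\<exists>F. query_poly N M (2 * queries A) F \<and>
    (\<forall>f\<in>function_space N M. F f = of_real (output_prob N M A f v))"
proof -
  obtain F where F: "\<And>w. query_poly N M (queries A) (F w)"
    "\<And>w f. f \<in> function_space N M \<Longrightarrow> state_after N M A f (queries A) w = F w f"
    using state_after_query_poly by metis
  define B where "B = {(i, b, z) \<in> basis N M (workspace A). last z = v}"
  have "query_poly N M (queries A + queries A) (\<lambda>f. \<Sum>x\<in>B. F x f * cnj (F x f))"
    by (intro query_poly_sum query_poly_mult query_poly_cnj F)
  moreover have "(\<Sum>x\<in>B. F x f * cnj (F x f)) = of_real (output_prob N M A f v)"
    if f: "f \<in> function_space N M" for f
    unfolding output_prob_def final_state_def B_def[symmetric]
    by (simp add: F(2)[OF f] complex_norm_square[symmetric] split_def)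
  ultimately show ?thesis by (intro exI[of _ "\<lambda>f. \<Sum>x\<in>B. F x f * cnj (F x f)"]) (simp add: mult_2)
qed

section \<open>Conservation of total probability\<close>

text \<open>Orthonormality of the columns, the property shared by gates and queries from which
  preservation of the norm follows.\<close>

definition isometric_on :: "label set \<Rightarrow> operator \<Rightarrow> bool" where
  "isometric_on B U \<longleftrightarrow> (\<forall>x\<in>B. \<forall>y\<in>B. (\<Sum>z\<in>B. cnj (U z x) * U z y) = (if x = y then 1 else 0))"

lemma isometric_on_norm:
  assumes "finite B" "isometric_on B U"
  shows "(\<Sum>x\<in>B. (cmod (op_apply B U v x))\<^sup>2) = (\<Sum>x\<in>B. (cmod (v x))\<^sup>2)"
proof -
  have "complex_of_real (\<Sum>x\<in>B. (cmod (op_apply B U v x))\<^sup>2) =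
      (\<Sum>z\<in>B. (\<Sum>y\<in>B. U z y * v y) * (\<Sum>x\<in>B. cnj (U z x) * cnj (v x)))"
    by (simp add: op_apply_def complex_norm_square del: of_real_power)
  also have "\<dots> = (\<Sum>z\<in>B. \<Sum>y\<in>B. \<Sum>x\<in>B. (U z y * v y) * (cnj (U z x) * cnj (v x)))"
    by (simp only: sum_product)
  \<comment> \<open>The sum over rows is moved innermost, where it becomes the inner product of two
    columns.\<close>
  also have "\<dots> = (\<Sum>y\<in>B. \<Sum>z\<in>B. \<Sum>x\<in>B. (U z y * v y) * (cnj (U z x) * cnj (v x)))"
    by (rule sum.swap)
  also have "\<dots> = (\<Sum>y\<in>B. \<Sum>x\<in>B. \<Sum>z\<in>B. (U z y * v y) * (cnj (U z x) * cnj (v x)))"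
    by (intro sum.cong sum.swap refl)
  also have "\<dots> = (\<Sum>y\<in>B. \<Sum>x\<in>B. v y * cnj (v x) * (\<Sum>z\<in>B. cnj (U z x) * U z y))"
    by (simp add: sum_distrib_left mult_ac)
  also have "\<dots> = (\<Sum>y\<in>B. \<Sum>x\<in>B. v y * cnj (v x) * (if x = y then 1 else 0))"
    using assms(2) unfolding isometric_on_def by (intro sum.cong refl) simp
  also have "\<dots> = (\<Sum>y\<in>B. v y * cnj (v y))"
    using assms(1) by (simp add: if_distrib[of "\<lambda>x. _ * x"] sum.delta' cong: if_cong)
  also have "\<dots> = complex_of_real (\<Sum>x\<in>B. (cmod (v x))\<^sup>2)"
    by (simp add: complex_norm_square del: of_real_power)
  finally show ?thesis by (simp only: of_real_eq_iff)
qed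

text \<open>The query permutes the basis labels; injectivity is cancellation of \<open>f i\<close>
  modulo \<open>M\<close>.\<close>

lemma isometric_on_query_op:
  assumes "f \<in> function_space N M"
  shows "isometric_on (basis N M m) (query_op M f)"
  unfolding isometric_on_def
proof (intro ballI)
  let ?B = "basis N M m" and ?q = "query_label M f"
  fix x y assume xy: "x \<in> ?B" "y \<in> ?B"
  obtain i b z where x: "x = (i, b, z)" by (cases x)
  obtain i' b' z' where y: "y = (i', b', z')" by (cases y)
  have qx: "?q x \<in> ?B" using xy by (auto simp: x basis_def)
  have inj: "?q x = ?q y \<longleftrightarrow> x = y"
  proof
    assume "?q x = ?q y"
    then have eq: "i = i'" "z = z'" "(b + f i) mod M = (b' + f i) mod M" by (auto simp: x y)
    have "b < M" "b' < M" using xy by (auto simp: x y basis_def)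
    moreover have eq_if: "c = a" if "c < M" "a \<le> c" "(a + f i) mod M = (c + f i) mod M" for a c
    proof -
      have "M dvd (c + f i) - (a + f i)"
        using that by (subst mod_eq_dvd_iff_nat[symmetric]) auto
      then have "c - a = 0" using that(1) by (auto dest: dvd_imp_le)
      then show ?thesis using that(2) by simp
    qed
    ultimately have "b = b'"
      using eq(3) by (cases b b' rule: le_cases) (metis eq_if)+
    then show "x = y" using eq x y by simp
  qed simp
  have "(\<Sum>z\<in>?B. cnj (query_op M f z x) * query_op M f z y) = (\<Sum>z\<in>?B. if z = ?q x then (if ?q x = ?q y then 1 else 0) else 0)"
    by (intro sum.cong) (auto simp: query_op_def ket_def)
  also have "\<dots> = (if ?q x = ?q y then 1 else 0)"
    using qx finite_basis by simp
  finally show "(\<Sum>z\<in>?B. cnj (query_op M f z x) * query_op M f z y) = (if x = y then 1 else 0)"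
    by (simp add: inj)
qed

text \<open>Turns a large probability of \<open>False\<close> into a small probability of
  \<open>True\<close>, so that one polynomial separates both kinds of input.\<close>

lemma output_prob_total:
  assumes "valid_algorithm N M A" "f \<in> function_space N M"
  shows "output_prob N M A f True + output_prob N M A f False = 1"
proof -
  let ?B = "basis N M (workspace A)"
  have gate: "isometric_on ?B (gate A t)" if "t \<le> queries A" for t
    using assms(1) that unfolding valid_algorithm_def unitary_on_def isometric_on_def by blast
  have norm: "(\<Sum>x\<in>?B. (cmod (state_after N M A f t x))\<^sup>2) = 1" if "t \<le> queries A" for t
    using that
  proof (induction t)
    case 0
    have "(\<Sum>x\<in>?B. (cmod (ket (start A) x))\<^sup>2) = (\<Sum>x\<in>?B. if x = start A then 1 else 0)"
      by (intro sum.cong) (auto simp: ket_def)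
    also have "\<dots> = 1" using assms(1) finite_basis by (simp add: valid_algorithm_def)
    finally show ?case by (simp add: isometric_on_norm[OF finite_basis gate])
  next
    case (Suc t)
    then show ?case
      by (simp add: isometric_on_norm[OF finite_basis gate] isometric_on_norm[OF finite_basis isometric_on_query_op[OF assms(2)]])
  qed
  define B where "B v = {(i, b, z) \<in> ?B. last z = v}" for v
  have prob: "output_prob N M A f v = (\<Sum>x\<in>B v. (cmod (final_state N M A f x))\<^sup>2)" for v
    unfolding output_prob_def B_def by (simp add: split_def)
  have "?B = B True \<union> B False" "B True \<inter> B False = {}" by (auto simp: B_def)
  then have "output_prob N M A f True + output_prob N M A f False = (\<Sum>x\<in>?B. (cmod (final_state N M A f x))\<^sup>2)"
    unfolding prob using finite_basis by (metis finite_Un sum.union_disjoint)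
  then show ?thesis using norm[of "queries A"] by (simp add: final_state_def)
qed

lemma output_prob_nonneg: "0 \<le> output_prob N M A f v"
  unfolding output_prob_def by (intro sum_nonneg) auto

section \<open>Polynomials that are bounded on integers\<close>

text \<open>The interpolant agrees with \<open>p\<close> at \<open>card I\<close> distinct points,
  and both have smaller degree. Indexing the nodes by \<open>I\<close> permits families such as
  squares or odd integers.\<close>

lemma lagrange_interpolation:
  fixes p :: "'a::field poly" and f :: "'b \<Rightarrow> 'a"
  assumes "finite I" "inj_on f I" "degree p < card I"
  shows "poly p x = (\<Sum>i\<in>I. poly p (f i) * (\<Prod>j\<in>I-{i}. (x - f j) / (f i - f j)))"
proof -
  define q where "q = (\<Sum>i\<in>I. smult (poly p (f i)) (\<Prod>j\<in>I-{i}. smult (1 / (f i - f j)) [:- f j, 1:]))"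
  have val: "poly q y = (\<Sum>i\<in>I. poly p (f i) * (\<Prod>j\<in>I-{i}. (y - f j) / (f i - f j)))" for y
    by (simp add: q_def poly_sum poly_prod diff_divide_distrib)
  have "degree q \<le> card I - 1"
    unfolding q_def
  proof (rule degree_sum_le)
    fix i assume i: "i \<in> I"
    have "degree (\<Prod>j\<in>I-{i}. smult (1 / (f i - f j)) [:- f j, 1:])
        \<le> (\<Sum>j\<in>I-{i}. degree (smult (1 / (f i - f j)) [:- f j, 1:]))"
      using degree_prod_sum_le[of "I-{i}" "\<lambda>j. smult (1 / (f i - f j)) [:- f j, 1:]"] assms(1)
      unfolding o_def by blast
    also have "\<dots> \<le> (\<Sum>j\<in>I-{i}. 1)"
      by (rule sum_mono) (simp add: degree_smult_le)
    also have "\<dots> = card I - 1" using assms(1) i by simp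
    finally show "degree (smult (poly p (f i)) (\<Prod>j\<in>I-{i}. smult (1 / (f i - f j)) [:- f j, 1:]))
      \<le> card I - 1"
      by (rule order_trans[OF degree_smult_le])
  qed (fact assms(1))
  moreover have "poly q (f k) = poly p (f k)" if k: "k \<in> I" for k
  proof -
    have "(\<Prod>j\<in>I-{i}. (f k - f j) / (f i - f j)) = (if i = k then 1 else 0)" if i: "i \<in> I" for i
    proof (cases "i = k")
      case True
      then show ?thesis
        using inj_on_eq_iff[OF assms(2)] k by (intro trans[OF prod.neutral]) auto
    next
      case False
      then have "k \<in> I - {i}" using k by simp
      then have "(\<Prod>j\<in>I-{i}. (f k - f j) / (f i - f j)) = 0"
        using assms(1) by (intro prod_zero bexI[of _ k]) auto
      then show ?thesis using False by simp
    qed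
    then have "poly q (f k) = (\<Sum>i\<in>I. poly p (f i) * (if i = k then 1 else 0))"
      unfolding val by (intro sum.cong) auto
    also have "\<dots> = poly p (f k)"
      using assms(1) k by (simp add: if_distrib[of "\<lambda>x. _ * x"] sum.delta cong: if_cong)
    finally show ?thesis .
  qed
  moreover have "card (f ` I) = card I" using assms(2) by (rule card_image)
  ultimately have "q = p"
    using assms(3) by (intro poly_eqI_degree[where A = "f ` I"]) auto
  then show ?thesis using val by metis
qed

lemma norm_poly_le_lagrange:
  fixes p :: "complex poly" and f :: "'b \<Rightarrow> real"
  assumes "finite I" "inj_on f I" "degree p < card I"
  shows "cmod (poly p (of_real x)) \<le>
    (\<Sum>i\<in>I. cmod (poly p (of_real (f i))) * (\<Prod>j\<in>I-{i}. \<bar>x - f j\<bar> / \<bar>f i - f j\<bar>))"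
proof -
  have "inj_on (\<lambda>i. complex_of_real (f i)) I" using assms(2) by (simp add: inj_on_def)
  then have "poly p (of_real x) = (\<Sum>i\<in>I. poly p (of_real (f i)) *
      (\<Prod>j\<in>I-{i}. (of_real x - of_real (f j)) / (of_real (f i) - of_real (f j))))"
    using lagrange_interpolation[of I "\<lambda>i. complex_of_real (f i)" p] assms by blast
  also have "cmod \<dots> \<le> (\<Sum>i\<in>I. cmod (poly p (of_real (f i)) *
      (\<Prod>j\<in>I-{i}. (of_real x - of_real (f j)) / (of_real (f i) - of_real (f j)))))"
    by (rule norm_sum)
  also have "\<dots> = (\<Sum>i\<in>I. cmod (poly p (of_real (f i))) * (\<Prod>j\<in>I-{i}. \<bar>x - f j\<bar> / \<bar>f i - f j\<bar>))"
    by (simp add: norm_mult norm_divide prod_norm[symmetric] flip: of_real_diff)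
  finally show ?thesis .
qed

lemma sum_inverse_squares_le: "(\<Sum>j\<in>{1..m::nat}. 1 / (real j)\<^sup>2) \<le> 2"
proof -
  \<comment> \<open>The subtracted term makes the induction close by telescoping.\<close>
  have "(\<Sum>j\<in>{1..Suc m}. 1 / (real j)\<^sup>2) \<le> 2 - 1 / real (Suc m)" for m
  proof (induction m)
    case (Suc m)
    have "1 / (real (Suc (Suc m)))\<^sup>2 \<le> 1 / (real (Suc m) * real (Suc (Suc m)))"
      unfolding power2_eq_square by (intro divide_left_mono mult_right_mono) auto
    also have "\<dots> = 1 / real (Suc m) - 1 / real (Suc (Suc m))"
      by (simp add: field_simps)
    finally show ?case using Suc by simp
  qed simp
  from this[of "m - 1"] show ?thesis
    by (cases m) (auto intro: order_trans)
qed

section \<open>Interpolation weights for square nodes\<close>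

text \<open>The factors below \<open>e\<close> give one factorial and those above it the other. Both
  node families use this for their denominators.\<close>

lemma prod_abs_diff_eq_fact:
  assumes "e < n"
  shows "(\<Prod>c\<in>{..<n}-{e}. \<bar>real c - real e\<bar>) = fact e * fact (n - 1 - e)"
proof -
  have sets: "{..<n}-{e} = {..<e} \<union> {e<..<n}" using assms by auto
  have "(\<Prod>c\<in>{..<n}-{e}. \<bar>real c - real e\<bar>) =
      (\<Prod>c\<in>{..<e}. \<bar>real c - real e\<bar>) * (\<Prod>c\<in>{e<..<n}. \<bar>real c - real e\<bar>)"
    unfolding sets by (rule prod.union_disjoint) auto
  also have "(\<Prod>c\<in>{..<e}. \<bar>real c - real e\<bar>) = (\<Prod>c\<in>{0..<e}. real (e - c))"
    by (intro prod.cong) (auto simp: of_nat_diff)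
  also have "\<dots> = fact e" by (simp add: fact_prod_rev)
  also have "(\<Prod>c\<in>{e<..<n}. \<bar>real c - real e\<bar>) = (\<Prod>c\<in>{1..n-1-e}. real c)"
    by (rule prod.reindex_bij_witness[of _ "\<lambda>c. c + e" "\<lambda>c. c - e"]) auto
  also have "\<dots> = fact (n - 1 - e)" by (simp add: fact_prod)
  finally show ?thesis .
qed

text \<open>The product equals 2 (m!)^2 / ((m+j)! (m-j)!), and the central binomial coefficient is
  the largest one.\<close>

lemma square_node_weight:
  fixes m j :: nat
  assumes "1 \<le> j" "j \<le> m"
  shows "(\<Prod>l\<in>{1..m}-{j}. (real l)\<^sup>2 / \<bar>(real l)\<^sup>2 - (real j)\<^sup>2\<bar>) \<le> 2"
proof -
  have split: "\<bar>(real l)\<^sup>2 - (real j)\<^sup>2\<bar> = \<bar>real l - real j\<bar> * (real l + real j)" for l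
    by (simp add: power2_eq_square square_diff_square_factored abs_mult)
  have num: "(\<Prod>l\<in>{1..m}-{j}. (real l)\<^sup>2) * (real j)\<^sup>2 = (fact m)\<^sup>2"
    using assms prod.remove[of "{1..m}" j "\<lambda>l. (real l)\<^sup>2"]
    by (simp add: fact_prod prod_power_distrib mult.commute)
  have "(\<Prod>l\<in>{..<Suc m}-{j}. \<bar>real l - real j\<bar>) = fact j * fact (m - j)"
    using prod_abs_diff_eq_fact[of j "Suc m"] assms by simp
  \<comment> \<open>Adding l = 0 completes the range of the factorial formula and costs a factor
    \<open>j\<close>.\<close>
  moreover have "{..<Suc m}-{j} = insert 0 ({1..m}-{j})" using assms by auto
  ultimately have den1: "real j * (\<Prod>l\<in>{1..m}-{j}. \<bar>real l - real j\<bar>) = fact j * fact (m - j)"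
    by simp
  have "(\<Prod>l\<in>{1..m}. real l + real j) = (\<Prod>l\<in>{j+1..m+j}. real l)"
    by (rule prod.reindex_bij_witness[of _ "\<lambda>c. c - j" "\<lambda>c. c + j"]) auto
  moreover have "(\<Prod>l\<in>{j+1..m+j}. real l) * fact j = fact (m + j)"
  proof -
    have "{1..m+j} = {1..j} \<union> {j+1..m+j}" by auto
    then have "(\<Prod>l\<in>{1..m+j}. real l) = (\<Prod>l\<in>{1..j}. real l) * (\<Prod>l\<in>{j+1..m+j}. real l)"
      by (simp add: prod.union_disjoint)
    then show ?thesis by (simp add: fact_prod mult.commute)
  qed
  moreover have "(\<Prod>l\<in>{1..m}. real l + real j) = (2 * real j) * (\<Prod>l\<in>{1..m}-{j}. real l + real j)"
    using assms prod.remove[of "{1..m}" j "\<lambda>l. real l + real j"] by simp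
  ultimately have den2: "(2 * real j) * (\<Prod>l\<in>{1..m}-{j}. real l + real j) * fact j = fact (m + j)"
    by simp
  define A B C where "A = (\<Prod>l\<in>{1..m}-{j}. (real l)\<^sup>2)"
    and "B = (\<Prod>l\<in>{1..m}-{j}. \<bar>real l - real j\<bar>)" and "C = (\<Prod>l\<in>{1..m}-{j}. real l + real j)"
  have pos: "B > 0" "C > 0" "real j > 0" using assms unfolding B_def C_def
    by (auto intro!: prod_pos)
  have "(2 * m) choose (m + j) \<le> (2 * m) choose m" using binomial_maximum[of "2*m" "m+j"] by simp
  moreover have "real ((2 * m) choose (m + j)) = fact (2 * m) / (fact (m + j) * fact (m - j))"
    using assms by (subst binomial_fact) auto
  moreover have "real ((2 * m) choose m) = fact (2 * m) / (fact m * fact m)"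
    by (subst binomial_fact) auto
  ultimately have "fact (2 * m) / (fact (m + j) * fact (m - j)) \<le> fact (2 * m) / (fact m * (fact m :: real))"
    by (metis of_nat_le_iff)
  then have le: "(fact m)\<^sup>2 \<le> fact (m + j) * (fact (m - j) :: real)"
    by (simp add: field_simps power2_eq_square)
  have "A * (real j)\<^sup>2 \<le> fact (m + j) * fact (m - j)"
    using num le by (simp add: A_def)
  also have "fact (m + j) * fact (m - j) = (2 * real j) * C * (fact j * fact (m - j))"
    using den2 by (simp add: C_def)
  also have "\<dots> = 2 * (B * C) * (real j)\<^sup>2"
    unfolding den1[symmetric] B_def[symmetric] by (simp add: power2_eq_square)
  finally have "A \<le> 2 * (B * C)" using pos by simp
  then have "A / (B * C) \<le> 2" using pos by (simp add: field_simps)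
  then show ?thesis
    by (simp add: split prod_dividef prod.distrib A_def B_def C_def)
qed

text \<open>Interpolation at the nodes \<open>1\<close> and \<open>c j\<^sup>2\<close>: the sparser the squares, the smaller their total
  weight at \<open>0\<close>.\<close>

lemma poly_consecutive_values_close:
  fixes p :: "complex poly" and c d :: nat
  assumes deg: "degree p \<le> d" and c: "2 \<le> c"
    and bd: "\<And>k. k \<le> 1 + c * d\<^sup>2 \<Longrightarrow> cmod (poly p (of_nat k)) \<le> K"
  shows "cmod (poly p 0 - poly p 1) \<le> 16 * K / c"
proof -
  \<comment> \<open>Index 0 is the node 1. It differs from every c j^2 because c >= 2.\<close>
  define f where "f j = (if j = 0 then 1 else real (c * j\<^sup>2))" for j :: nat
  have inj: "inj_on f {..d}"
  proof (rule inj_onI)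
    fix x y assume "f x = f y"
    moreover have "real (c * x\<^sup>2) \<noteq> 1" for x
      
    proof -
      have "c * x\<^sup>2 \<noteq> 1" using c by simp
      then show ?thesis by (metis of_nat_eq_1_iff)
    qed
    moreover have "c * x\<^sup>2 = c * y\<^sup>2 \<Longrightarrow> x = y" using c by (simp add: power2_eq_iff_nonneg)
    ultimately show "x = y" unfolding f_def by (metis of_nat_eq_iff)
  qed
  \<comment> \<open>Subtracting the value at 1 removes the term of that node, so only the sparse
    nodes contribute.\<close>
  define q where "q = p - [:poly p 1:]"
  have "degree q \<le> d" using deg unfolding q_def by (intro degree_diff_le) auto
  then have "cmod (poly q (of_real 0)) \<le>
      (\<Sum>i\<in>{..d}. cmod (poly q (of_real (f i))) * (\<Prod>j\<in>{..d}-{i}. \<bar>0 - f j\<bar> / \<bar>f i - f j\<bar>))"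
    using inj by (intro norm_poly_le_lagrange) auto
  also have "\<dots> = (\<Sum>i\<in>{1..d}. cmod (poly q (of_real (f i))) * (\<Prod>j\<in>{..d}-{i}. \<bar>0 - f j\<bar> / \<bar>f i - f j\<bar>))"
    by (intro sum.mono_neutral_right) (auto simp: q_def f_def)
  also have "\<dots> \<le> (\<Sum>i\<in>{1..d}. (2 * K) * (4 / c * (1 / (real i)\<^sup>2)))"
  proof (intro sum_mono mult_mono)
    fix i assume i: "i \<in> {1..d}"
    have "c * i\<^sup>2 \<le> c * d\<^sup>2" using i by simp
    then have "cmod (poly p (of_nat (c * i\<^sup>2))) \<le> K" by (intro bd trans_le_add2)
    moreover have "cmod (poly p (of_nat 1)) \<le> K" by (intro bd) simp
    moreover have "poly q (of_real (f i)) = poly p (of_nat (c * i\<^sup>2)) - poly p 1"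
      using i by (simp add: q_def f_def)
    ultimately show "cmod (poly q (of_real (f i))) \<le> 2 * K"
      using norm_triangle_ineq4[of "poly p (of_nat (c * i\<^sup>2))" "poly p 1"] by simp
    have "{..d}-{i} = insert 0 ({1..d}-{i})" using i by auto
    then have "(\<Prod>j\<in>{..d}-{i}. \<bar>0 - f j\<bar> / \<bar>f i - f j\<bar>) =
        1 / \<bar>f i - 1\<bar> * (\<Prod>j\<in>{1..d}-{i}. \<bar>0 - f j\<bar> / \<bar>f i - f j\<bar>)"
      by (simp add: f_def)
    also have "(\<Prod>j\<in>{1..d}-{i}. \<bar>0 - f j\<bar> / \<bar>f i - f j\<bar>) =
        (\<Prod>l\<in>{1..d}-{i}. (real l)\<^sup>2 / \<bar>(real l)\<^sup>2 - (real i)\<^sup>2\<bar>)"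
    proof (rule prod.cong)
      fix j assume j: "j \<in> {1..d}-{i}"
      have "\<bar>f i - f j\<bar> = real c * \<bar>(real j)\<^sup>2 - (real i)\<^sup>2\<bar>"
        using i j c by (simp add: f_def abs_minus_commute abs_mult flip: right_diff_distrib)
      then show "\<bar>0 - f j\<bar> / \<bar>f i - f j\<bar> = (real j)\<^sup>2 / \<bar>(real j)\<^sup>2 - (real i)\<^sup>2\<bar>"
        using j c by (simp add: f_def)
    qed simp
    also have "1 / \<bar>f i - 1\<bar> * \<dots> \<le> 1 / \<bar>f i - 1\<bar> * 2"
      using i by (intro mult_left_mono square_node_weight) auto
    \<comment> \<open>The factor from the node 1 supplies both the gain 1/c and the summable decay
      1/i^2.\<close>
    also have "1 / \<bar>f i - 1\<bar> \<le> 2 / (real c * (real i)\<^sup>2)"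
    proof -
      have "1 * 2 \<le> (real i)\<^sup>2 * real c" using i c by (intro mult_mono) auto
      then have "2 \<le> real c * (real i)\<^sup>2" by (simp add: mult.commute)
      then show ?thesis using i by (simp add: f_def field_simps)
    qed
    finally show "(\<Prod>j\<in>{..d}-{i}. \<bar>0 - f j\<bar> / \<bar>f i - f j\<bar>) \<le> 4 / c * (1 / (real i)\<^sup>2)"
      by simp
    show "0 \<le> 2 * K" using order_trans[OF norm_ge_zero bd[of 0]] by simp
  qed (auto intro!: prod_nonneg)
  also have "\<dots> = 8 * K / c * (\<Sum>i\<in>{1..d}. 1 / (real i)\<^sup>2)"
    by (simp add: sum_distrib_left mult.assoc)
  also have "\<dots> \<le> 8 * K / c * 2"
    using order_trans[OF norm_ge_zero bd[of 0]]
    by (intro mult_left_mono sum_inverse_squares_le) auto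
  finally show ?thesis by (simp add: q_def)
qed

section \<open>Interpolation weights for odd nodes and zero\<close>

text \<open>Pairs each odd node with its negative. The monoid locale lets one reindexing serve both
  products of factors and sums of weights.\<close>

lemma (in comm_monoid_set) symmetric_odd_nodes:
  "F (\<lambda>j. g (2 * real j + 1 - 2 * real h)) {..<2 * h} =
   F (\<lambda>a. g (2 * real a + 1) \<^bold>* g (- (2 * real a + 1))) {..<h}"
proof -
  have sets: "{..<2 * h} = {..<h} \<union> {h..<2 * h}" by auto
  have "F (\<lambda>j. g (2 * real j + 1 - 2 * real h)) {..<2 * h} =
      F (\<lambda>j. g (2 * real j + 1 - 2 * real h)) {..<h} \<^bold>* F (\<lambda>j. g (2 * real j + 1 - 2 * real h)) {h..<2 * h}"
    unfolding sets by (rule union_disjoint) auto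
  also have "F (\<lambda>j. g (2 * real j + 1 - 2 * real h)) {h..<2 * h} = F (\<lambda>a. g (2 * real a + 1)) {..<h}"
    by (rule reindex_bij_witness[of _ "\<lambda>a. a + h" "\<lambda>j. j - h"]) (auto simp: of_nat_diff algebra_simps)
  also have "F (\<lambda>j. g (2 * real j + 1 - 2 * real h)) {..<h} = F (\<lambda>a. g (- (2 * real a + 1))) {..<h}"
    by (rule reindex_bij_witness[of _ "\<lambda>a. h - 1 - a" "\<lambda>j. h - 1 - j"]) (auto simp: of_nat_diff algebra_simps)
  finally show ?thesis by (simp add: distrib commute)
qed

text \<open>A Wallis-type estimate: the induction replaces (2g+1)(2g+3) by 4(g+1)^2.\<close>

lemma prod_odd_squares_le: "(\<Prod>a<Suc g. (2 * real a + 1)\<^sup>2) \<le> (2 * real g + 1) * 4 ^ g * (fact g)\<^sup>2"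
proof (induction g)
  case (Suc g)
  have "(\<Prod>a<Suc (Suc g). (2 * real a + 1)\<^sup>2) \<le>
      (2 * real g + 1) * 4 ^ g * (fact g)\<^sup>2 * (2 * real (Suc g) + 1)\<^sup>2"
    unfolding prod.lessThan_Suc[of _ "Suc g"] by (intro mult_right_mono Suc) simp
  also have "\<dots> = (2 * real (Suc g) + 1) * 4 ^ g * (fact g)\<^sup>2 * ((2 * real g + 1) * (2 * real g + 3))"
    by (simp add: power2_eq_square algebra_simps)
  also have "\<dots> \<le> (2 * real (Suc g) + 1) * 4 ^ g * (fact g)\<^sup>2 * (4 * (real (Suc g))\<^sup>2)"
    
  proof (rule mult_left_mono)
    show "(2 * real g + 1) * (2 * real g + 3) \<le> 4 * (real (Suc g))\<^sup>2"
      by (simp add: power2_eq_square algebra_simps)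
  qed simp
  also have "\<dots> = (2 * real (Suc g) + 1) * 4 ^ Suc g * (fact (Suc g))\<^sup>2"
    by (simp add: power2_eq_square algebra_simps)
  finally show ?case .
qed simp

lemma le_if_divide_le:
  fixes x y c :: real
  assumes "c / x \<le> c / y" "0 < c" "0 < x" "0 < y"
  shows "y \<le> x"
  using assms by (simp add: field_simps)

text \<open>With its missing factor restored, the numerator is a product of differences (2a+1)^2 -
  u^2. The denominator is a power of two times two factorials, and the middle binomial coefficient
  compares the two. The factor u/|t| comes from the node 0.\<close>

lemma odd_node_weight:
  fixes u :: real
  assumes h: "h = Suc g" and e: "e < 2 * h" and u: "0 \<le> u" "u < 1"
  defines "t \<equiv> \<lambda>j::nat. 2 * real j + 1 - 2 * real h"
  shows "u / \<bar>t e\<bar> * (\<Prod>j\<in>{..<2*h}-{e}. \<bar>u - t j\<bar> / \<bar>t e - t j\<bar>) \<le> 2 * (1 / (t e)\<^sup>2)"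
proof -
  have "odd (2 * int e + 1 - 2 * int h)" by simp
  moreover have te: "t e = of_int (2 * int e + 1 - 2 * int h)" by (simp add: t_def)
  moreover have "odd k \<Longrightarrow> k = 1 \<or> k \<ge> 3 \<or> k \<le> -1" for k :: int by presburger
  ultimately have cases: "t e = 1 \<or> t e \<ge> 3 \<or> t e \<le> -1" by (metis (no_types) of_int_1 of_int_le_iff of_int_minus of_int_numeral)
  then have ne: "u - t e \<noteq> 0" "t e \<noteq> 0" using u by auto
  define N where "N = (\<Prod>j\<in>{..<2*h}-{e}. \<bar>u - t j\<bar>)"
  have "\<bar>u - t e\<bar> * N = (\<Prod>j<2*h. \<bar>u - t j\<bar>)"
    unfolding N_def using e by (intro prod.remove[symmetric]) auto
  also have "\<dots> = (\<Prod>a<h. \<bar>u - (2 * real a + 1)\<bar> * \<bar>u - (- (2 * real a + 1))\<bar>)"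
    unfolding t_def by (rule prod.symmetric_odd_nodes)
  also have "\<dots> = (\<Prod>a<h. (2 * real a + 1)\<^sup>2 - u\<^sup>2)"
  proof (rule prod.cong)
    fix a
    have "\<bar>u - (2 * real a + 1)\<bar> = (2 * real a + 1) - u" "\<bar>u - (- (2 * real a + 1))\<bar> = (2 * real a + 1) + u"
      using u by auto
    then show "\<bar>u - (2 * real a + 1)\<bar> * \<bar>u - (- (2 * real a + 1))\<bar> = (2 * real a + 1)\<^sup>2 - u\<^sup>2"
      by (simp add: power2_eq_square algebra_simps)
  qed simp
  also have "\<dots> = (1 - u\<^sup>2) * (\<Prod>a<g. (2 * real (Suc a) + 1)\<^sup>2 - u\<^sup>2)"
    unfolding h by (subst prod.lessThan_Suc_shift) simp
  \<comment> \<open>The first factor keeps its u^2: it has to absorb the division by |u - t| at t =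
    1.\<close>
  also have "\<dots> \<le> (1 - u\<^sup>2) * (\<Prod>a<g. (2 * real (Suc a) + 1)\<^sup>2)"
  proof (intro mult_left_mono prod_mono conjI)
    fix a
    have "u\<^sup>2 \<le> (2 * real (Suc a) + 1)\<^sup>2" using u by (intro power_mono) auto
    then show "0 \<le> (2 * real (Suc a) + 1)\<^sup>2 - u\<^sup>2" by simp
    show "0 \<le> 1 - u\<^sup>2" using u by (simp add: power_le_one)
  qed auto
  also have "(\<Prod>a<g. (2 * real (Suc a) + 1)\<^sup>2) = (\<Prod>a<Suc g. (2 * real a + 1)\<^sup>2)"
    by (subst prod.lessThan_Suc_shift) simp
  also have "(1 - u\<^sup>2) * \<dots> \<le> (1 - u\<^sup>2) * ((2 * real g + 1) * 4 ^ g * (fact g)\<^sup>2)"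
    using u by (intro mult_left_mono prod_odd_squares_le) (auto simp: power_le_one)
  also have "\<dots> \<le> (1 - u\<^sup>2) * (2 ^ (2 * g + 1) * (fact g * fact (g + 1)))"
  proof (intro mult_left_mono)
    have four: "(4::real) ^ g = 2 ^ (2 * g)" by (simp add: power_mult)
    have "(2 * real g + 1) * (4 ^ g * (fact g)\<^sup>2) \<le> (2 * real g + 2) * (4 ^ g * (fact g)\<^sup>2)"
      by (intro mult_right_mono) auto
    also have "\<dots> = 2 ^ (2 * g + 1) * (fact g * fact (g + 1))"
      by (simp add: four power2_eq_square algebra_simps)
    finally show "(2 * real g + 1) * 4 ^ g * (fact g)\<^sup>2 \<le> 2 ^ (2 * g + 1) * (fact g * fact (g + 1))"
      by (simp add: mult.assoc)
  qed (use u in \<open>auto simp: power_le_one\<close>)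
  also have "\<dots> \<le> (1 - u\<^sup>2) * (2 ^ (2 * g + 1) * (fact e * fact (2 * g + 1 - e)))"
  proof (intro mult_left_mono)
    have "(2 * g + 1) choose e \<le> (2 * g + 1) choose g" using binomial_maximum[of "2 * g + 1" e] by simp
    moreover have "real ((2 * g + 1) choose e) = fact (2 * g + 1) / (fact e * fact (2 * g + 1 - e))"
      using e h by (subst binomial_fact) auto
    moreover have "real ((2 * g + 1) choose g) = fact (2 * g + 1) / (fact g * fact (g + 1))"
      by (subst binomial_fact) auto
    ultimately have "fact (2 * g + 1) / (fact e * fact (2 * g + 1 - e)) \<le>
        fact (2 * g + 1) / (fact g * (fact (g + 1) :: real))"
      by (metis of_nat_le_iff)
    moreover have "0 < (fact (2 * g + 1) :: real)" by simp
    ultimately show "fact g * fact (g + 1) \<le> fact e * (fact (2 * g + 1 - e) :: real)"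
      using le_if_divide_le[of "fact (2 * g + 1)" "fact e * fact (2 * g + 1 - e)"] by simp
  qed (use u in \<open>auto simp: power_le_one\<close>)
  finally have N: "\<bar>u - t e\<bar> * N \<le> (1 - u\<^sup>2) * (2 ^ (2 * g + 1) * (fact e * fact (2 * g + 1 - e)))" .
  have "(\<Prod>j\<in>{..<2*h}-{e}. \<bar>t e - t j\<bar>) = (\<Prod>j\<in>{..<2*h}-{e}. 2 * \<bar>real j - real e\<bar>)"
    by (intro prod.cong) (auto simp: t_def abs_if)
  also have "\<dots> = 2 ^ (2 * g + 1) * (\<Prod>j\<in>{..<2*h}-{e}. \<bar>real j - real e\<bar>)"
    using e h by (simp add: prod.distrib)
  also have "\<dots> = 2 ^ (2 * g + 1) * (fact e * fact (2 * g + 1 - e))"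
    using prod_abs_diff_eq_fact[OF e] h by simp
  finally have D: "(\<Prod>j\<in>{..<2*h}-{e}. \<bar>t e - t j\<bar>) = 2 ^ (2 * g + 1) * (fact e * fact (2 * g + 1 - e))" .
  define W where "W = (2 ^ (2 * g + 1) * (fact e * fact (2 * g + 1 - e)) :: real)"
  have "W > 0" unfolding W_def by simp
  then have "N / W \<le> (1 - u\<^sup>2) / \<bar>u - t e\<bar>"
    using N[folded W_def] ne by (simp add: pos_divide_le_eq pos_le_divide_eq mult.commute)
  then have "u / \<bar>t e\<bar> * (N / W) \<le> u / \<bar>t e\<bar> * ((1 - u\<^sup>2) / \<bar>u - t e\<bar>)"
    using u by (intro mult_left_mono) auto
  also have "\<dots> \<le> 2 * (1 / (t e)\<^sup>2)"
  proof -
    \<comment> \<open>At t = 1 the factor 1 - u cancels; every other odd t satisfies |t| <= 2|u -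
      t|.\<close>
    have "u * (1 - u\<^sup>2) * \<bar>t e\<bar> \<le> 2 * \<bar>u - t e\<bar>"
    proof -
      have 1: "u * (1 - u\<^sup>2) \<le> 1" "0 \<le> u * (1 - u\<^sup>2)"
        using u by (auto intro!: mult_le_one simp: power_le_one)
      have 2: "u * (1 - u\<^sup>2) * \<bar>t e\<bar> \<le> 1 * \<bar>t e\<bar>" using 1 by (intro mult_right_mono) auto
      show ?thesis
      proof (cases "t e = 1")
        case True
        have "u * (1 + u) * (1 - u) \<le> 2 * (1 - u)"
          using u mult_mono[of u 1 "1 + u" 2] by (intro mult_right_mono) auto
        then show ?thesis using True u by (simp add: power2_eq_square algebra_simps)
      next
        case False
        then have "\<bar>t e\<bar> \<le> 2 * \<bar>u - t e\<bar>" using False cases u by (auto simp: abs_if)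
        then show ?thesis using 2 by linarith
      qed
    qed
    moreover have "a / y * (b / v) \<le> 2 * (1 / y\<^sup>2)" if "a * b * y \<le> 2 * v" "y > 0" "v > 0" for a b y v :: real
    proof -
      have "a * b * y / (y\<^sup>2 * v) \<le> 2 * v / (y\<^sup>2 * v)" using that by (intro divide_right_mono) auto
      then show ?thesis using that by (simp add: power2_eq_square)
    qed
    ultimately have "u / \<bar>t e\<bar> * ((1 - u\<^sup>2) / \<bar>u - t e\<bar>) \<le> 2 * (1 / \<bar>t e\<bar>\<^sup>2)"
      using ne by (metis zero_less_abs_iff)
    then show ?thesis by simp
  qed
  finally show ?thesis
    by (simp add: prod_dividef D N_def[symmetric] W_def)
qed

text \<open>Interpolation at \<open>0\<close> and the odd integers up to \<open>2h - 1\<close> in absolute value. The extra node \<open>0\<close>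
  makes the weight of \<open>t\<close> decay like \<open>1 / t\<^sup>2\<close>; with the odd nodes alone the weights would add up to
  something of order \<open>ln h\<close>.\<close>

lemma poly_bounded_between_integers:
  fixes p :: "complex poly" and u :: real
  assumes deg: "degree p \<le> 2 * h" and u: "0 \<le> u" "u < 1"
    and bd: "\<And>s::int. \<bar>s\<bar> \<le> 2 * int h \<Longrightarrow> cmod (poly p (of_int s)) \<le> 1"
  shows "cmod (poly p (of_real u)) \<le> 9"
proof -
  define t where "t j = 2 * real j + 1 - 2 * real h" for j :: nat
  \<comment> \<open>The index 2h, beyond those of the odd nodes, stands for the node 0.\<close>
  define f where "f j = (if j = 2 * h then 0 else t j)" for j
  have t_int: "t j = of_int (2 * int j + 1 - 2 * int h)" for j by (simp add: t_def)
  have "odd (2 * int j + 1 - 2 * int h)" for j by simp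
  then have t_ne: "t j \<noteq> 0" for j unfolding t_int of_int_eq_0_iff by (metis even_zero)
  have inj: "inj_on f {..2 * h}"
    using t_ne by (auto simp: inj_on_def f_def t_def split: if_splits)
  define w where "w e = (\<Prod>j\<in>{..2*h}-{e}. \<bar>u - f j\<bar> / \<bar>f e - f j\<bar>)" for e
  have "cmod (poly p (of_real u)) \<le> (\<Sum>e\<in>{..2*h}. cmod (poly p (of_real (f e))) * w e)"
    unfolding w_def using inj deg by (intro norm_poly_le_lagrange) auto
  also have "\<dots> \<le> (\<Sum>e\<in>{..2*h}. 1 * w e)"
  proof (intro sum_mono mult_right_mono)
    fix e assume e: "e \<in> {..2*h}"
    define s where "s = (if e = 2 * h then 0 else 2 * int e + 1 - 2 * int h)"
    have "f e = of_int s" unfolding f_def s_def t_int by simp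
    moreover have "\<bar>s\<bar> \<le> 2 * int h" using e unfolding s_def by auto
    ultimately show "cmod (poly p (of_real (f e))) \<le> 1" using bd[of s] by simp
  qed (auto simp: w_def intro!: prod_nonneg)
  also have "\<dots> = (\<Sum>e<2*h. w e) + w (2 * h)"
    by (simp flip: lessThan_Suc_atMost)
  also have "w (2 * h) \<le> 1"
  proof -
    have "{..2*h}-{2*h} = {..<2*h}" by auto
    then have "w (2 * h) = (\<Prod>j<2*h. \<bar>u - t j\<bar> / \<bar>t j\<bar>)"
      unfolding w_def by (intro prod.cong) (auto simp: f_def)
    also have "\<dots> = (\<Prod>a<h. (\<bar>u - (2 * real a + 1)\<bar> / \<bar>2 * real a + 1\<bar>) *
        (\<bar>u - (- (2 * real a + 1))\<bar> / \<bar>- (2 * real a + 1)\<bar>))"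
      unfolding t_def by (rule prod.symmetric_odd_nodes)
    \<comment> \<open>Opposite nodes b and -b together contribute 1 - u^2/b^2.\<close>
    also have "\<dots> \<le> 1"
    proof (intro prod_le_1 conjI)
      fix a
      define b where "b = 2 * real a + 1"
      have b: "b \<ge> 1" by (simp add: b_def)
      have "\<bar>u - b\<bar> * \<bar>u + b\<bar> = b\<^sup>2 - u\<^sup>2"
        using u b by (simp add: power2_eq_square algebra_simps)
      then have "\<bar>u - b\<bar> * \<bar>u + b\<bar> \<le> b * b" by (simp add: power2_eq_square)
      then show "(\<bar>u - (2 * real a + 1)\<bar> / \<bar>2 * real a + 1\<bar>) *
        (\<bar>u - (- (2 * real a + 1))\<bar> / \<bar>- (2 * real a + 1)\<bar>) \<le> 1"
        unfolding b_def[symmetric] using b by (simp add: field_simps)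
    qed auto
    finally show ?thesis .
  qed
  also have "(\<Sum>e<2*h. w e) \<le> (\<Sum>e<2*h. 2 * (1 / (t e)\<^sup>2))"
  proof (rule sum_mono)
    fix e assume e: "e \<in> {..<2*h}"
    then obtain g where g: "h = Suc g" by (cases h) auto
    have "{..2*h}-{e} = insert (2*h) ({..<2*h}-{e})" using e by auto
    then have "w e = u / \<bar>t e\<bar> * (\<Prod>j\<in>{..<2*h}-{e}. \<bar>u - f j\<bar> / \<bar>f e - f j\<bar>)"
      using u e by (simp add: w_def f_def)
    also have "(\<Prod>j\<in>{..<2*h}-{e}. \<bar>u - f j\<bar> / \<bar>f e - f j\<bar>) = (\<Prod>j\<in>{..<2*h}-{e}. \<bar>u - t j\<bar> / \<bar>t e - t j\<bar>)"
      using e by (intro prod.cong) (auto simp: f_def)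
    finally show "w e \<le> 2 * (1 / (t e)\<^sup>2)"
      using odd_node_weight[OF g _ u] e unfolding t_def by simp
  qed
  also have "(\<Sum>e<2*h. 2 * (1 / (t e)\<^sup>2)) = (\<Sum>a<h. 2 * (1 / (2 * real a + 1)\<^sup>2) + 2 * (1 / (- (2 * real a + 1))\<^sup>2))"
    unfolding t_def by (rule sum.symmetric_odd_nodes)
  \<comment> \<open>The odd nodes weigh at most 8 in total and the node 0 at most 1, which gives
    9.\<close>
  also have "\<dots> \<le> (\<Sum>a<h. 4 * (1 / (real (Suc a))\<^sup>2))"
  proof (rule sum_mono)
    fix a
    have "1 / (2 * real a + 1)\<^sup>2 \<le> 1 / (real (Suc a))\<^sup>2"
      by (intro divide_left_mono power_mono) auto
    moreover have "(- (2 * real a + 1))\<^sup>2 = (2 * real a + 1)\<^sup>2" by (rule power2_minus)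
    ultimately show "2 * (1 / (2 * real a + 1)\<^sup>2) + 2 * (1 / (- (2 * real a + 1))\<^sup>2) \<le> 4 * (1 / (real (Suc a))\<^sup>2)"
      by (simp only:)
  qed
  also have "\<dots> = (\<Sum>j\<in>{1..h}. 4 * (1 / (real j)\<^sup>2))"
    by (rule sum.reindex_bij_witness[of _ "\<lambda>j. j - 1" Suc]) auto
  also have "\<dots> = 4 * (\<Sum>j\<in>{1..h}. 1 / (real j)\<^sup>2)"
    by (simp only: sum_distrib_left)
  also have "\<dots> \<le> 4 * 2" by (intro mult_left_mono sum_inverse_squares_le) simp
  finally show ?thesis by simp
qed

section \<open>From a gap to a degree bound\<close>

text \<open>Some a = k of order d^2 makes \<open>R\<close> exceed 9 at \<open>m0\<close>, since
  otherwise the values at a = 1 and a = 2 are too close. For this k, bounds at enough multiples of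
  2k around \<open>m0\<close> would force a value at most 9 there. So one side of \<open>m0\<close>
  is shorter than 4kd.\<close>

lemma sections_gap_imp_degree:
  fixes R :: "complex \<Rightarrow> complex \<Rightarrow> complex" and V m0 d c :: nat and \<delta> :: real
  assumes sec_a: "\<And>m. \<exists>p. degree p \<le> d \<and> (\<forall>a. R m a = poly p a)"
    and sec_m: "\<And>a. \<exists>p. degree p \<le> d \<and> (\<forall>m. R m a = poly p m)"
    and bd: "\<And>m a::nat. 1 \<le> a \<Longrightarrow> 2 * a dvd m \<Longrightarrow> m \<le> V \<Longrightarrow> cmod (R (of_nat m) (of_nat a)) \<le> 1"
    and gap: "\<delta> \<le> cmod (R (of_nat m0) 1 - R (of_nat m0) 2)" "0 < \<delta>"
    and c: "144 < \<delta> * c" "2 \<le> c"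
    and mid: "V \<le> 4 * m0" "m0 \<le> V" "V \<le> 4 * (V - m0)"
  shows "V < 16 * (2 + c) * d ^ 3"
proof -
  \<comment> \<open>Degree zero leaves no room for a gap. Positivity later absorbs lower-order terms
    into a single cube.\<close>
  have "d > 0"
  proof (rule ccontr)
    assume "\<not> d > 0"
    then obtain p where p: "degree p = 0" "\<forall>a. R (of_nat m0) a = poly p a" using sec_a by auto
    then have "R (of_nat m0) 1 = R (of_nat m0) 2" by (auto elim: degree_eq_zeroE)
    then show False using gap by simp
  qed
  have "\<exists>k. 1 \<le> k \<and> k \<le> 2 + c * d\<^sup>2 \<and> cmod (R (of_nat m0) (of_nat k)) > 9"
  proof (rule ccontr)
    assume neg: "\<not> ?thesis"
    obtain p where p: "degree p \<le> d" "\<And>a. R (of_nat m0) a = poly p a" using sec_a by meson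
    \<comment> \<open>The bounds start at a = 1, so the arguments 1 and 2 are shifted to 0 and
      1.\<close>
    define q where "q = pcompose p [:1, 1:]"
    have q: "poly q x = R (of_nat m0) (1 + x)" for x by (simp add: q_def poly_pcompose p)
    have "cmod (poly q 0 - poly q 1) \<le> 16 * 9 / c"
    proof (rule poly_consecutive_values_close)
      show "degree q \<le> d" using p(1) by (simp add: q_def degree_pcompose)
      fix k assume "k \<le> 1 + c * d\<^sup>2"
      then have "cmod (R (of_nat m0) (of_nat (1 + k))) \<le> 9" using neg by (force simp: not_less)
      then show "cmod (poly q (of_nat k)) \<le> 9" by (simp add: q)
    qed (use c in auto)
    \<comment> \<open>The constant 144 in the hypothesis on \<open>c\<close> is this 16 * 9.\<close>
    moreover have "16 * 9 / c < \<delta>" using c by (simp add: field_simps)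
    ultimately show False using gap by (simp add: q)
  qed
  then obtain k where k: "1 \<le> k" "k \<le> 2 + c * d\<^sup>2" "cmod (R (of_nat m0) (of_nat k)) > 9" by blast
  have small: "m0 < 4 * k * d \<or> V - m0 < 4 * k * d"
  proof (rule ccontr)
    assume "\<not> ?thesis"
    then have far: "4 * k * d \<le> m0" "4 * k * d \<le> V - m0" by auto
    obtain p where p: "degree p \<le> d" "\<And>m. R m (of_nat k) = poly p m" using sec_m by meson
    \<comment> \<open>In units of 2k, \<open>m0\<close> sits at i + u; the polynomial
      \<open>q\<close> below uses these units with origin at i.\<close>
    define i where "i = m0 div (2 * k)"
    define u where "u = real (m0 mod (2 * k)) / (2 * k)"
    have m0: "2 * k * i + m0 mod (2 * k) = m0" unfolding i_def by simp
    have modlt: "m0 mod (2 * k) < 2 * k" using k by simp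
    have "2 * d \<le> i"
    proof -
      have "(2 * k) * (2 * d) div (2 * k) \<le> i" unfolding i_def by (rule div_le_mono) (use far in simp)
      then show ?thesis using k by simp
    qed
    define q where "q = pcompose p [:of_nat (2 * k * i), of_nat (2 * k):]"
    have q: "poly q x = R (of_nat (2 * k * i) + x * of_nat (2 * k)) (of_nat k)" for x
      by (simp add: q_def poly_pcompose p)
    have "cmod (poly q (of_real u)) \<le> 9"
    proof (rule poly_bounded_between_integers)
      show "degree q \<le> 2 * d" using p(1) k by (simp add: q_def degree_pcompose)
      show "0 \<le> u" "u < 1"
        using k of_nat_less_iff[where 'a = real, THEN iffD2, OF modlt] by (auto simp: u_def)
      fix s :: int assume s: "\<bar>s\<bar> \<le> 2 * int d"
      \<comment> \<open>\<open>s\<close> may be negative; 2d <= i keeps i + s a natural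
        number.\<close>
      define j where "j = nat (int i + s)"
      have j: "int j = int i + s" using s \<open>2 * d \<le> i\<close> by (simp add: j_def)
      have "complex_of_int (2 * int k * int i + s * (2 * int k)) = of_int (2 * int k * int j)"
        unfolding j by (simp add: algebra_simps)
      then have "poly q (of_int s) = R (of_nat (2 * k * j)) (of_nat k)"
        by (simp add: q)
      moreover have "j \<le> i + 2 * d" using j s by linarith
      then have "2 * k * j \<le> 2 * k * (i + 2 * d)" by (intro mult_left_mono) auto
      then have "2 * k * j \<le> V" using m0 far mid by (simp add: algebra_simps)
      ultimately show "cmod (poly q (of_int s)) \<le> 1" using bd[of k "2 * k * j"] k by simp
    qed
    moreover have "complex_of_nat (2 * k * i) + of_real u * of_nat (2 * k) = of_nat m0"
    proof -
      have "of_real u * of_nat (2 * k) = complex_of_nat (m0 mod (2 * k))"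
        using k by (simp add: u_def)
      then show ?thesis using m0 by (metis of_nat_add)
    qed
    ultimately show False using k by (simp add: q)
  qed
  have "V < 16 * (k * d)" using small mid by (auto simp: algebra_simps)
  also have "16 * (k * d) \<le> 16 * ((2 + c * d\<^sup>2) * d)"
    by (intro mult_left_mono mult_right_mono k) auto
  also have "\<dots> \<le> 16 * ((2 * d\<^sup>2 + c * d\<^sup>2) * d)"
    using \<open>d > 0\<close> by (intro mult_left_mono mult_right_mono add_right_mono) auto
  also have "\<dots> = 16 * (2 + c) * d ^ 3" by (simp add: power2_eq_square power3_eq_cube algebra_simps)
  finally show ?thesis .
qed

section \<open>Averaging over points and colours\<close>

text \<open>The complements of \<open>I\<close> and of its image have equal size, so a bijection
  between them completes \<open>\<tau>\<close>.\<close>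

lemma ex_permutes_extension:
  assumes "finite X" "I \<subseteq> X" "inj_on \<tau> I" "\<tau> ` I \<subseteq> X"
  shows "\<exists>\<rho>. \<rho> permutes X \<and> (\<forall>i\<in>I. \<rho> i = \<tau> i)"
proof -
  have "finite I" using assms(1,2) finite_subset by blast
  then have "card (X - I) = card (X - \<tau> ` I)"
    using assms by (simp add: card_Diff_subset card_image)
  then obtain g where g: "bij_betw g (X - I) (X - \<tau> ` I)"
    using assms(1) finite_same_card_bij by blast
  define \<rho> where "\<rho> x = (if x \<in> I then \<tau> x else if x \<in> X then g x else x)" for x
  have "bij_betw \<rho> I (\<tau> ` I)"
    using assms(3) by (subst bij_betw_cong[of I \<rho> \<tau>]) (auto simp: \<rho>_def inj_on_imp_bij_betw)
  moreover have "bij_betw \<rho> (X - I) (X - \<tau> ` I)"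
    using g by (subst bij_betw_cong[of _ \<rho> g]) (auto simp: \<rho>_def)
  ultimately have "bij_betw \<rho> (I \<union> (X - I)) (\<tau> ` I \<union> (X - \<tau> ` I))"
    by (rule bij_betw_combine) auto
  then have "bij_betw \<rho> X X" using assms(2,4) by (simp add: Un_absorb1)
  then have "\<rho> permutes X" by (rule bij_imp_permutes) (use assms(2) in \<open>auto simp: \<rho>_def\<close>)
  then show ?thesis by (intro exI[of _ \<rho>]) (simp add: \<rho>_def)
qed

text \<open>The order of the pointwise stabilizer. It is left unevaluated: what matters is that it
  depends only on \<open>X\<close> and \<open>I\<close>.\<close>

definition stabilizer_card :: "'a set \<Rightarrow> 'a set \<Rightarrow> nat" where
  "stabilizer_card X I = card {\<pi>. \<pi> permutes X \<and> (\<forall>i\<in>I. \<pi> i = i)}"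

text \<open>The extensions of \<open>\<tau>\<close> form a coset of the pointwise
  stabilizer.\<close>

lemma card_permutes_extending:
  assumes "finite X" "I \<subseteq> X" "inj_on \<tau> I" "\<tau> ` I \<subseteq> X"
  shows "card {\<pi>. \<pi> permutes X \<and> (\<forall>i\<in>I. \<pi> i = \<tau> i)} = stabilizer_card X I"
proof -
  obtain \<rho> where \<rho>: "\<rho> permutes X" "\<forall>i\<in>I. \<rho> i = \<tau> i"
    using ex_permutes_extension[OF assms] by blast
  have inv: "inv \<rho> (\<rho> x) = x" "\<rho> (inv \<rho> x) = x" for x
    using \<rho>(1) permutes_inverses by metis+
  have "bij_betw (\<lambda>\<pi>. \<rho> \<circ> \<pi>) {\<pi>. \<pi> permutes X \<and> (\<forall>i\<in>I. \<pi> i = i)} {\<pi>. \<pi> permutes X \<and> (\<forall>i\<in>I. \<pi> i = \<tau> i)}"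
  proof (rule bij_betw_byWitness[where f' = "\<lambda>\<pi>. inv \<rho> \<circ> \<pi>"])
    show "(\<lambda>\<pi>. \<rho> \<circ> \<pi>) ` {\<pi>. \<pi> permutes X \<and> (\<forall>i\<in>I. \<pi> i = i)} \<subseteq> {\<pi>. \<pi> permutes X \<and> (\<forall>i\<in>I. \<pi> i = \<tau> i)}"
      using \<rho> by (auto intro: permutes_compose)
    show "(\<lambda>\<pi>. inv \<rho> \<circ> \<pi>) ` {\<pi>. \<pi> permutes X \<and> (\<forall>i\<in>I. \<pi> i = \<tau> i)} \<subseteq> {\<pi>. \<pi> permutes X \<and> (\<forall>i\<in>I. \<pi> i = i)}"
      using \<rho> inv by (auto intro!: permutes_compose permutes_inv) (metis inv(1))
  qed (auto simp: inv fun_eq_iff)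
  then show ?thesis unfolding stabilizer_card_def by (rule bij_betw_same_card[symmetric])
qed

section \<open>Random inputs from a colouring\<close>

text \<open>Moves the occurring colours into the range; the random permutation applied afterwards
  makes the choice of injection immaterial.\<close>

definition relabel :: "nat \<Rightarrow> nat \<Rightarrow> (nat \<Rightarrow> nat) \<Rightarrow> nat \<Rightarrow> nat" where
  "relabel n M g = (SOME \<rho>. inj_on \<rho> (g ` {1..n}) \<and> \<rho> ` g ` {1..n} \<subseteq> {1..M})"

definition sample :: "nat \<Rightarrow> nat \<Rightarrow> (nat \<Rightarrow> nat) \<Rightarrow> (nat \<Rightarrow> nat) \<Rightarrow> nat \<Rightarrow> nat" where
  "sample n M g \<pi> = restrict (\<pi> \<circ> relabel n M g \<circ> g) {1..n}"

lemma relabel: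
  assumes "n \<le> M"
  shows "inj_on (relabel n M g) (g ` {1..n})" "relabel n M g ` g ` {1..n} \<subseteq> {1..M}"
proof -
  have "card (g ` {1..n}) \<le> card {1..M}" using card_image_le[of "{1..n}" g] assms by simp
  then have "\<exists>\<rho>. inj_on \<rho> (g ` {1..n}) \<and> \<rho> ` g ` {1..n} \<subseteq> {1..M}"
    using card_le_inj[of "g ` {1..n}" "{1..M}"] by (meson finite_atLeastAtMost finite_imageI)
  from someI_ex[OF this] show "inj_on (relabel n M g) (g ` {1..n})" "relabel n M g ` g ` {1..n} \<subseteq> {1..M}"
    unfolding relabel_def by auto
qed

lemma relabel_in:
  assumes "n \<le> M" "i \<in> {1..n}"
  shows "relabel n M g (g i) \<in> {1..M}"
  using relabel(2)[OF assms(1), of g] assms(2) by (simp add: image_subset_iff)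

lemma relabel_eq_iff:
  assumes "n \<le> M" "i \<in> {1..n}" "i' \<in> {1..n}"
  shows "relabel n M g (g i) = relabel n M g (g i') \<longleftrightarrow> g i = g i'"
  using inj_on_eq_iff[OF relabel(1)[OF assms(1), of g]] assms by blast

lemma sample_in_function_space:
  assumes "n \<le> M" "\<pi> permutes {1..M}"
  shows "sample n M g \<pi> \<in> function_space n M"
  using relabel_in[OF assms(1)] permutes_in_image[OF assms(2)]
  by (auto simp: sample_def function_space_def simp del: atLeastAtMost_iff)

lemma sample_eq_iff:
  assumes "n \<le> M" "\<pi> permutes {1..M}" "i \<in> {1..n}" "i' \<in> {1..n}"
  shows "sample n M g \<pi> i = sample n M g \<pi> i' \<longleftrightarrow> g i = g i'"
  using relabel_eq_iff[OF assms(1,3,4)] assms(3,4) inj_eq[OF permutes_inj[OF assms(2)]]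
  by (simp add: sample_def)

text \<open>The coincidences of \<open>g\<close> are exactly those demanded by \<open>S\<close>. A
  contradictory \<open>S\<close> fails for every \<open>g\<close>, as the case of equal indices
  shows.\<close>

definition same_kernel :: "(nat \<times> nat) set \<Rightarrow> (nat \<Rightarrow> nat) \<Rightarrow> bool" where
  "same_kernel S g \<longleftrightarrow> (\<forall>(i, j)\<in>S. \<forall>(i', j')\<in>S. g i = g i' \<longleftrightarrow> j = j')"

lemma same_kernelD:
  "same_kernel S g \<Longrightarrow> (i, j) \<in> S \<Longrightarrow> (i', j') \<in> S \<Longrightarrow> g i = g i' \<longleftrightarrow> j = j'"
  unfolding same_kernel_def by fast

lemma same_kernel_cong:
  assumes "\<And>x. x \<in> S \<Longrightarrow> g (fst x) = g' (fst x)"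
  shows "same_kernel S g \<longleftrightarrow> same_kernel S g'"
  using assms by (simp add: same_kernel_def split_def)

text \<open>Sampled values coincide exactly when colours do, so a wrong pattern contributes nothing.
  For the right pattern the permutation has prescribed values at distinct points, and the number of
  such permutations depends on \<open>S\<close> alone.\<close>

lemma sum_monomial_sample:
  assumes nM: "n \<le> M" and S: "S \<subseteq> {1..n} \<times> {1..M}"
  shows "(\<Sum>\<pi> | \<pi> permutes {1..M}. monomial S (sample n M g \<pi>)) =
    of_nat (stabilizer_card {1..M} (snd ` S)) * of_bool (same_kernel S g)"
proof -
  let ?P = "{\<pi>. \<pi> permutes {1..M}}"
  have dom: "i \<in> {1..n}" if "(i, j) \<in> S" for i j using S that by auto
  define Q where "Q = {\<pi>. \<pi> permutes {1..M} \<and> (\<forall>(i, j)\<in>S. sample n M g \<pi> i = j)}"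
  have "(\<Sum>\<pi>\<in>?P. monomial S (sample n M g \<pi>)) =
      (\<Sum>\<pi>\<in>?P. if \<forall>(i, j)\<in>S. sample n M g \<pi> i = j then 1 else 0)"
    by (simp add: monomial_def)
  also have "\<dots> = (\<Sum>\<pi>\<in>Q. 1)"
    unfolding Q_def by (rule sum.mono_neutral_cong_right) (auto simp: finite_permutations)
  also have "\<dots> = of_nat (card Q)" by simp
  also have "card Q = stabilizer_card {1..M} (snd ` S) * of_bool (same_kernel S g)"
  proof (cases "same_kernel S g")
    case False
    have "same_kernel S g" if \<pi>: "\<pi> \<in> Q" for \<pi>
      unfolding same_kernel_def
    proof (intro ballI, clarify)
      fix i j i' j' assume ij: "(i, j) \<in> S" "(i', j') \<in> S"
      then have "sample n M g \<pi> i = sample n M g \<pi> i' \<longleftrightarrow> g i = g i'"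
        using \<pi> S by (intro sample_eq_iff[OF nM]) (auto simp: Q_def)
      moreover have "sample n M g \<pi> i = j" "sample n M g \<pi> i' = j'" using ij \<pi> by (auto simp: Q_def)
      ultimately show "g i = g i' \<longleftrightarrow> j = j'" by simp
    qed
    then have "Q = {}" using False by auto
    then show ?thesis using False by simp
  next
    case True
    \<comment> \<open>The relabelled colour that must be renamed to \<open>j\<close>. The kernel
      condition makes the chosen index irrelevant.\<close>
    define \<theta> where "\<theta> j = relabel n M g (g (SOME i. (i, j) \<in> S))" for j
    have \<theta>: "\<theta> j = relabel n M g (g i)" if "(i, j) \<in> S" for i j
    proof -
      have "(SOME i. (i, j) \<in> S, j) \<in> S" using that by (rule someI)
      then have "g (SOME i. (i, j) \<in> S) = g i" using same_kernelD[OF True _ that] by blast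
      then show ?thesis by (simp add: \<theta>_def)
    qed
    have range: "\<theta> ` snd ` S \<subseteq> {1..M}"
      using \<theta> S relabel_in[OF nM] by (auto simp del: atLeastAtMost_iff)
    have "inj_on \<theta> (snd ` S)"
    proof (rule inj_onI)
      fix j j' assume "j \<in> snd ` S" "j' \<in> snd ` S" and eq: "\<theta> j = \<theta> j'"
      then obtain i i' where i: "(i, j) \<in> S" "(i', j') \<in> S" by auto
      then have "g i = g i'" using eq \<theta>[OF i(1)] \<theta>[OF i(2)] relabel_eq_iff[OF nM dom dom, OF i] by simp
      moreover have "g i = g i' \<longleftrightarrow> j = j'"
        by (rule same_kernelD[OF True i])
      ultimately show "j = j'" by simp
    qed
    then have "card {\<pi>. \<pi> permutes {1..M} \<and> (\<forall>j\<in>snd ` S. \<pi> j = \<theta> j)} = stabilizer_card {1..M} (snd ` S)"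
      using S range by (intro card_permutes_extending) auto
    \<comment> \<open>Sending \<open>\<theta> j\<close> to \<open>j\<close> fixes the inverse at
      \<open>j\<close>, and the set of such \<open>j\<close> does not depend on
      \<open>g\<close>.\<close>
    moreover have "bij_betw inv {\<pi>. \<pi> permutes {1..M} \<and> (\<forall>j\<in>snd ` S. \<pi> j = \<theta> j)} Q"
    proof -
      have iff: "sample n M g (inv \<pi>) i = j \<longleftrightarrow> \<pi> j = \<theta> j" if "\<pi> permutes {1..M}" "(i, j) \<in> S" for \<pi> i j
      proof -
        have "sample n M g (inv \<pi>) i = inv \<pi> (\<theta> j)"
          using \<theta>[OF that(2)] dom[OF that(2)] by (simp add: sample_def)
        then show ?thesis using permutes_inv_eq[OF that(1)] by auto
      qed
      show ?thesis
      proof (rule bij_betw_byWitness[where f' = inv])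
        show "inv ` {\<pi>. \<pi> permutes {1..M} \<and> (\<forall>j\<in>snd ` S. \<pi> j = \<theta> j)} \<subseteq> Q"
          using iff by (auto simp: Q_def permutes_inv)
        show "inv ` Q \<subseteq> {\<pi>. \<pi> permutes {1..M} \<and> (\<forall>j\<in>snd ` S. \<pi> j = \<theta> j)}"
        proof safe
          fix \<pi> assume "\<pi> \<in> Q"
          then show "inv \<pi> permutes {1..M}" by (auto simp: Q_def permutes_inv)
          fix i j assume "(i, j) \<in> S"
          then show "inv \<pi> (snd (i, j)) = \<theta> (snd (i, j))"
            using \<open>\<pi> \<in> Q\<close> iff[of "inv \<pi>" i j] by (auto simp: Q_def permutes_inv permutes_inv_inv)
        qed
      qed (auto simp: Q_def permutes_inv_inv)
    qed
    ultimately show ?thesis using True bij_betw_same_card by fastforce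
  qed
  finally show ?thesis by simp
qed

text \<open>Permutations are grouped by their restriction to the queried indices. All fibres have
  equal size, so the random points form a uniform injective placement.\<close>

lemma sum_same_kernel_permutes:
  fixes h :: "nat \<Rightarrow> nat"
  assumes "finite X" "fst ` S \<subseteq> X"
  shows "(\<Sum>\<sigma> | \<sigma> permutes X. of_bool (same_kernel S (h \<circ> \<sigma>))) =
    (of_nat (stabilizer_card X (fst ` S) *
      card {\<tau> \<in> fst ` S \<rightarrow>\<^sub>E X. inj_on \<tau> (fst ` S) \<and> same_kernel S (h \<circ> \<tau>)}) :: complex)"
proof -
  let ?I = "fst ` S"
  define T where "T = {\<tau> \<in> ?I \<rightarrow>\<^sub>E X. inj_on \<tau> ?I \<and> same_kernel S (h \<circ> \<tau>)}"
  define Q where "Q = {\<sigma>. \<sigma> permutes X \<and> same_kernel S (h \<circ> \<sigma>)}"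
  have finI: "finite ?I" using assms finite_subset by blast
  have fins: "finite {\<sigma>. \<sigma> permutes X}" "finite Q" "finite T"
    using finite_permutations[OF assms(1)] finite_PiE[OF finI, of "\<lambda>_. X"] assms(1)
    by (auto simp: Q_def T_def)
  have kernel: "same_kernel S (h \<circ> restrict \<sigma> ?I) \<longleftrightarrow> same_kernel S (h \<circ> \<sigma>)" for \<sigma>
    by (rule same_kernel_cong) auto
  have "(\<Sum>\<sigma> | \<sigma> permutes X. of_bool (same_kernel S (h \<circ> \<sigma>))) = (\<Sum>\<sigma>\<in>Q. 1 :: complex)"
    unfolding Q_def using fins by (intro sum.mono_neutral_cong_right) auto
  also have "\<dots> = (\<Sum>\<tau>\<in>T. \<Sum>\<sigma>\<in>{\<sigma>\<in>Q. restrict \<sigma> ?I = \<tau>}. 1)"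
  proof (rule sum.group[symmetric])
    show "(\<lambda>\<sigma>. restrict \<sigma> ?I) ` Q \<subseteq> T"
    proof safe
      fix \<sigma> assume \<sigma>: "\<sigma> \<in> Q"
      then have "restrict \<sigma> ?I \<in> ?I \<rightarrow>\<^sub>E X"
        using assms(2) permutes_in_image[of \<sigma> X] by (auto simp: Q_def)
      moreover have "inj_on (restrict \<sigma> ?I) ?I"
        using \<sigma> permutes_inj_on[of \<sigma> X ?I] unfolding Q_def by (auto simp: inj_on_restrict_eq simp del: inj_on_image_iff)
      ultimately show "restrict \<sigma> ?I \<in> T" using \<sigma> kernel by (simp add: T_def Q_def)
    qed
  qed (use fins in auto)
  also have "\<dots> = (\<Sum>\<tau>\<in>T. of_nat (stabilizer_card X ?I))"
  proof (rule sum.cong)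
    fix \<tau> assume \<tau>: "\<tau> \<in> T"
    have "{\<sigma>\<in>Q. restrict \<sigma> ?I = \<tau>} = {\<sigma>. \<sigma> permutes X \<and> (\<forall>i\<in>?I. \<sigma> i = \<tau> i)}"
    proof safe
      fix \<sigma> assume \<sigma>: "\<sigma> permutes X" "\<forall>i\<in>?I. \<sigma> i = \<tau> i"
      show eq: "restrict \<sigma> ?I = \<tau>"
        using \<tau> \<sigma> by (auto simp: T_def fun_eq_iff PiE_def extensional_def)
      show "\<sigma> \<in> Q" using \<tau> \<sigma> kernel[of \<sigma>] unfolding Q_def T_def eq by simp
    qed (force simp: Q_def)+
    moreover have "card {\<sigma>. \<sigma> permutes X \<and> (\<forall>i\<in>?I. \<sigma> i = \<tau> i)} = stabilizer_card X ?I"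
      using \<tau> assms by (intro card_permutes_extending) (auto simp: T_def)
    ultimately show "(\<Sum>\<sigma>\<in>{\<sigma>\<in>Q. restrict \<sigma> ?I = \<tau>}. 1) = (of_nat (stabilizer_card X ?I) :: complex)"
      by simp
  qed simp
  finally show ?thesis by (simp add: T_def mult.commute)
qed

section \<open>Counting placements with a given coincidence pattern\<close>

text \<open>The degree bound is for each variable separately, with the other one fixed.\<close>

definition bipoly :: "nat \<Rightarrow> (complex \<Rightarrow> complex \<Rightarrow> complex) \<Rightarrow> bool" where
  "bipoly d R \<longleftrightarrow> (\<forall>m. \<exists>p. degree p \<le> d \<and> (\<forall>a. R m a = poly p a)) \<and>
     (\<forall>a. \<exists>p. degree p \<le> d \<and> (\<forall>m. R m a = poly p m))"

lemma bipoly_mult: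
  assumes "bipoly d R" "bipoly e R'"
  shows "bipoly (d + e) (\<lambda>m a. R m a * R' m a)"
  unfolding bipoly_def
proof (intro conjI allI)
  fix m
  obtain p q where "degree p \<le> d" "\<And>a. R m a = poly p a" "degree q \<le> e" "\<And>a. R' m a = poly q a"
    using assms unfolding bipoly_def by meson
  then show "\<exists>r. degree r \<le> d + e \<and> (\<forall>a. R m a * R' m a = poly r a)"
    using degree_mult_le[of p q] by (intro exI[of _ "p * q"]) simp
next
  fix a
  obtain p q where "degree p \<le> d" "\<And>m. R m a = poly p m" "degree q \<le> e" "\<And>m. R' m a = poly q m"
    using assms unfolding bipoly_def by meson
  then show "\<exists>r. degree r \<le> d + e \<and> (\<forall>m. R m a * R' m a = poly r m)"
    using degree_mult_le[of p q] by (intro exI[of _ "p * q"]) simp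
qed

lemma bipoly_add:
  assumes "bipoly d R" "bipoly d R'"
  shows "bipoly d (\<lambda>m a. R m a + R' m a)"
  unfolding bipoly_def
proof (intro conjI allI)
  fix m
  obtain p q where "degree p \<le> d" "\<And>a. R m a = poly p a" "degree q \<le> d" "\<And>a. R' m a = poly q a"
    using assms unfolding bipoly_def by meson
  then show "\<exists>r. degree r \<le> d \<and> (\<forall>a. R m a + R' m a = poly r a)"
    by (intro exI[of _ "p + q"]) (simp add: degree_add_le)
next
  fix a
  obtain p q where "degree p \<le> d" "\<And>m. R m a = poly p m" "degree q \<le> d" "\<And>m. R' m a = poly q m"
    using assms unfolding bipoly_def by meson
  then show "\<exists>r. degree r \<le> d \<and> (\<forall>m. R m a + R' m a = poly r m)"
    by (intro exI[of _ "p + q"]) (simp add: degree_add_le)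
qed

lemma bipoly_affine:
  "bipoly 1 (\<lambda>m a. a + c)" "bipoly 1 (\<lambda>m a. m + a * c + c')"
  unfolding bipoly_def
proof safe
  show "\<exists>p. degree p \<le> 1 \<and> (\<forall>a. a + c = poly p a)"
    by (intro exI[of _ "[:c, 1:]"]) (simp add: add.commute)
  show "\<exists>p. degree p \<le> 1 \<and> (\<forall>m::complex. a + c = poly p m)" for a
    by (intro exI[of _ "[:a + c:]"]) simp
  show "\<exists>p. degree p \<le> 1 \<and> (\<forall>a. m + a * c + c' = poly p a)" for m
    by (intro exI[of _ "[:m + c', c:]"]) (simp add: algebra_simps)
  show "\<exists>p. degree p \<le> 1 \<and> (\<forall>m. m + a * c + c' = poly p m)" for a
    by (intro exI[of _ "[:a * c + c', 1:]"]) (simp add: algebra_simps)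
qed

lemma bipoly_const: "bipoly d (\<lambda>m a. c)"
  unfolding bipoly_def by (intro conjI allI exI[of _ "[:c:]"]) auto

lemma bipoly_mono: "bipoly d R \<Longrightarrow> d \<le> e \<Longrightarrow> bipoly e R"
  unfolding bipoly_def by (meson le_trans)

lemma bipoly_cmult: "bipoly d R \<Longrightarrow> bipoly d (\<lambda>m a. c * R m a)"
  using bipoly_mult[OF bipoly_const[of 0 c]] by simp

lemma bipoly_sum:
  assumes "\<And>x. x \<in> A \<Longrightarrow> bipoly d (R x)"
  shows "bipoly d (\<lambda>m a. \<Sum>x\<in>A. R x m a)"
  using assms by (induction A rule: infinite_finite_induct) (simp_all add: bipoly_const bipoly_add)

section \<open>Extending placements one index at a time\<close>

text \<open>The type is a predicate on colours, so no class is mixed. One colouring may satisfy this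
  for several parameters, and then its average is a value of several functions.\<close>

definition two_sized_classes ::
  "'a set \<Rightarrow> ('a \<Rightarrow> 'c) \<Rightarrow> ('c \<Rightarrow> bool) \<Rightarrow> nat \<Rightarrow> nat \<Rightarrow> nat \<Rightarrow> bool" where
  "two_sized_classes X h ty m a b \<longleftrightarrow> finite X \<and> card {x \<in> X. ty (h x)} = m \<and>
     (\<forall>x\<in>X. card {y \<in> X. h y = h x} = (if ty (h x) then a else b))"

text \<open>\<open>j\<close> encodes the coincidence pattern and \<open>B\<close> the blocks that go
  to classes of the first type. With types fixed, the number of ways to add an index no longer
  depends on the placement.\<close>

definition typed_placements ::
  "'a set \<Rightarrow> ('a \<Rightarrow> 'c) \<Rightarrow> ('c \<Rightarrow> bool) \<Rightarrow> ('i \<Rightarrow> 'j) \<Rightarrow> 'j set \<Rightarrow> 'i set \<Rightarrow> ('i \<Rightarrow> 'a) set" where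
  "typed_placements X h ty j B I = {\<tau> \<in> I \<rightarrow>\<^sub>E X. inj_on \<tau> I \<and>
     (\<forall>i\<in>I. \<forall>i'\<in>I. h (\<tau> i) = h (\<tau> i') \<longleftrightarrow> j i = j i') \<and> (\<forall>i\<in>I. ty (h (\<tau> i)) \<longleftrightarrow> j i \<in> B)}"

text \<open>The number of admissible images for a new index \<open>i\<close>: the unused points of the class that \<open>j i\<close>
  already occupies, or the points of the prescribed type outside all occupied classes.\<close>

definition extension_count ::
  "nat \<Rightarrow> nat \<Rightarrow> ('i \<Rightarrow> 'j) \<Rightarrow> 'j set \<Rightarrow> 'i set \<Rightarrow> 'i \<Rightarrow> complex \<Rightarrow> complex \<Rightarrow> complex" where
  "extension_count V b j B I i m a =
     (if j i \<in> j ` I then (if j i \<in> B then a else of_nat b) - of_nat (card {i' \<in> I. j i' = j i})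
      else (if j i \<in> B then m else of_nat V - m) -
        (if j i \<in> B then a else of_nat b) * of_nat (card (j ` {i' \<in> I. j i' \<in> B \<longleftrightarrow> j i \<in> B})))"

lemma bipoly_extension_count: "bipoly 1 (extension_count V b j B I i)"
proof -
  let ?k = "of_nat (card {i' \<in> I. j i' = j i}) :: complex"
  let ?l = "of_nat (card (j ` {i' \<in> I. j i' \<in> B \<longleftrightarrow> j i \<in> B})) :: complex"
  consider "j i \<in> j ` I" "j i \<in> B" | "j i \<in> j ` I" "j i \<notin> B" | "j i \<notin> j ` I" "j i \<in> B" | "j i \<notin> j ` I" "j i \<notin> B"
    by blast
  then show ?thesis
  proof cases
    case 1
    then show ?thesis using bipoly_affine(1)[of "- ?k"]
      by (simp add: extension_count_def[abs_def])
  next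
    case 2
    then show ?thesis using bipoly_const[of 1 "of_nat b - ?k"]
      by (simp add: extension_count_def[abs_def])
  next
    case 3
    then show ?thesis using bipoly_affine(2)[of "- ?l" 0]
      by (simp add: extension_count_def[abs_def])
  next
    case 4
    then show ?thesis using bipoly_cmult[OF bipoly_affine(2)[of 0 "of_nat b * ?l - of_nat V"], of "-1"]
      by (simp add: extension_count_def[abs_def] algebra_simps)
  qed
qed

lemma card_image_eq_if_same_kernel:
  assumes "\<And>x y. x \<in> K \<Longrightarrow> y \<in> K \<Longrightarrow> p x = p y \<longleftrightarrow> q x = q y"
  shows "card (p ` K) = card (q ` K)"
proof -
  have eq: "(\<lambda>v. q (inv_into K p v)) (p x) = q x" if "x \<in> K" for x
    using assms that by (metis f_inv_into_f imageI inv_into_into)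
  then have "(\<lambda>v. q (inv_into K p v)) ` p ` K = q ` K" by (force simp: image_image)
  moreover have "inj_on (\<lambda>v. q (inv_into K p v)) (p ` K)"
    using eq assms by (auto simp: inj_on_def)
  ultimately show ?thesis by (metis card_image)
qed

lemma card_allowed_extensions:
  assumes cls: "two_sized_classes X h ty m a b" and \<tau>: "\<tau> \<in> typed_placements X h ty j B I"
    and fin: "finite I"
  shows "of_nat (card {x \<in> X. x \<notin> \<tau> ` I \<and> (\<forall>i'\<in>I. h x = h (\<tau> i') \<longleftrightarrow> j i = j i') \<and> (ty (h x) \<longleftrightarrow> j i \<in> B)}) =
    extension_count (card X) b j B I i (of_nat m) (of_nat a)"
proof -
  let ?A = "{x \<in> X. x \<notin> \<tau> ` I \<and> (\<forall>i'\<in>I. h x = h (\<tau> i') \<longleftrightarrow> j i = j i') \<and> (ty (h x) \<longleftrightarrow> j i \<in> B)}"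
  have finX: "finite X" and cm: "card {x \<in> X. ty (h x)} = m"
    and size: "\<And>x. x \<in> X \<Longrightarrow> card {y \<in> X. h y = h x} = (if ty (h x) then a else b)"
    using cls unfolding two_sized_classes_def by auto
  have \<tau>X: "\<And>i. i \<in> I \<Longrightarrow> \<tau> i \<in> X" and inj: "inj_on \<tau> I"
    and ker: "\<And>i i'. i \<in> I \<Longrightarrow> i' \<in> I \<Longrightarrow> h (\<tau> i) = h (\<tau> i') \<longleftrightarrow> j i = j i'"
    and ty: "\<And>i. i \<in> I \<Longrightarrow> ty (h (\<tau> i)) \<longleftrightarrow> j i \<in> B"
    using \<tau> unfolding typed_placements_def by auto
  define s where "s = (if j i \<in> B then a else b)"
  show ?thesis
  proof (cases "j i \<in> j ` I")
    case True
    then obtain i0 where i0: "i0 \<in> I" "j i = j i0" by blast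
    define C where "C = {y \<in> X. h y = h (\<tau> i0)}"
    define K where "K = {i' \<in> I. j i' = j i}"
    have "?A = C - \<tau> ` K"
    proof (intro set_eqI iffI)
      fix x assume "x \<in> ?A"
      then show "x \<in> C - \<tau> ` K" using i0 by (auto simp: C_def K_def)
    next
      fix x assume x: "x \<in> C - \<tau> ` K"
      then have hx: "x \<in> X" "h x = h (\<tau> i0)" by (auto simp: C_def)
      have "x \<notin> \<tau> ` I"
      proof
        assume "x \<in> \<tau> ` I"
        then obtain i' where i': "i' \<in> I" "x = \<tau> i'" by blast
        then have "j i' = j i" using ker[OF i'(1) i0(1)] hx i0 by simp
        then show False using x i' by (auto simp: K_def)
      qed
      moreover have "\<forall>i'\<in>I. h x = h (\<tau> i') \<longleftrightarrow> j i = j i'" using ker[OF i0(1)] hx i0 by simp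
      moreover have "ty (h x) \<longleftrightarrow> j i \<in> B" using ty[OF i0(1)] hx i0 by simp
      ultimately show "x \<in> ?A" using hx by simp
    qed
    \<comment> \<open>Inclusion makes the subtraction of cardinalities exact, so it agrees with
      complex subtraction.\<close>
    moreover have "\<tau> ` K \<subseteq> C" using \<tau>X ker[OF _ i0(1)] i0 by (auto simp: C_def K_def)
    moreover have "finite K" using fin by (simp add: K_def)
    moreover have "card (\<tau> ` K) = card K"
      using inj by (intro card_image) (auto simp: K_def inj_on_def)
    moreover have "card C = s" using size[OF \<tau>X[OF i0(1)]] ty[OF i0(1)] i0 by (simp add: C_def s_def)
    moreover have "finite C" using finX by (simp add: C_def)
    ultimately have "of_nat (card ?A) = of_nat s - (of_nat (card K) :: complex)"
      by (metis card_Diff_subset card_mono finite_imageI of_nat_diff)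
    then show ?thesis using True by (simp add: extension_count_def s_def K_def)
  next
    case False
    define K where "K = {i' \<in> I. j i' \<in> B \<longleftrightarrow> j i \<in> B}"
    define Y where "Y = {x \<in> X. ty (h x) \<longleftrightarrow> j i \<in> B}"
    \<comment> \<open>Only occupied classes of the type of the new block are removed; the others are
      disjoint from \<open>Y\<close>.\<close>
    define D where "D = {x \<in> X. h x \<in> (\<lambda>i'. h (\<tau> i')) ` K}"
    have "?A = Y - D"
    proof (intro set_eqI iffI)
      fix x assume "x \<in> ?A"
      then show "x \<in> Y - D" using False by (auto simp: Y_def D_def K_def)
    next
      fix x assume x: "x \<in> Y - D"
      then have xX: "x \<in> X" "ty (h x) \<longleftrightarrow> j i \<in> B" by (auto simp: Y_def)
      have ne: "h x \<noteq> h (\<tau> i')" if "i' \<in> I" for i'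
      proof
        assume eq: "h x = h (\<tau> i')"
        then have "i' \<in> K" using xX ty[OF that] that by (simp add: K_def)
        then show False using x xX eq by (auto simp: D_def)
      qed
      moreover have "j i \<noteq> j i'" if "i' \<in> I" for i' using False that by auto
      ultimately show "x \<in> ?A" using xX by auto
    qed
    moreover have "D \<subseteq> Y" using ty by (auto simp: D_def Y_def K_def)
    moreover have fY: "finite Y" using finX by (simp add: Y_def)
    ultimately have A: "of_nat (card ?A) = of_nat (card Y) - (of_nat (card D) :: complex)"
      by (metis card_Diff_subset card_mono finite_subset of_nat_diff)
    have Deq: "D = (\<Union>c\<in>(\<lambda>i'. h (\<tau> i')) ` K. {x \<in> X. h x = c})" by (auto simp: D_def)
    have "card D = (\<Sum>c\<in>(\<lambda>i'. h (\<tau> i')) ` K. card {x \<in> X. h x = c})"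
      unfolding Deq by (rule card_UN_disjoint) (use finX fin in \<open>auto simp: K_def\<close>)
    also have "\<dots> = (\<Sum>c\<in>(\<lambda>i'. h (\<tau> i')) ` K. s)"
    proof (rule sum.cong)
      fix c assume "c \<in> (\<lambda>i'. h (\<tau> i')) ` K"
      then obtain i' where i': "i' \<in> K" "c = h (\<tau> i')" by blast
      then have "i' \<in> I" by (simp add: K_def)
      then show "card {x \<in> X. h x = c} = s"
        using size[OF \<tau>X[OF \<open>i' \<in> I\<close>]] ty[OF \<open>i' \<in> I\<close>] i' by (simp add: K_def s_def)
    qed simp
    also have "\<dots> = card ((\<lambda>i'. h (\<tau> i')) ` K) * s" by simp
    \<comment> \<open>Occupied classes correspond to blocks of the pattern, so their number is
      independent of the placement.\<close>
    also have "card ((\<lambda>i'. h (\<tau> i')) ` K) = card (j ` K)"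
      by (rule card_image_eq_if_same_kernel) (auto simp: K_def ker)
    finally have D: "card D = card (j ` K) * s" .
    have Y: "of_nat (card Y) = (if j i \<in> B then of_nat m else of_nat (card X) - of_nat m :: complex)"
    proof (cases "j i \<in> B")
      case False
      have "Y = X - {x \<in> X. ty (h x)}" using False by (auto simp: Y_def)
      then have "card Y = card X - m" "m \<le> card X"
        using finX cm card_mono[of X "{x \<in> X. ty (h x)}"] by (auto simp: card_Diff_subset)
      then show ?thesis using False by (simp add: of_nat_diff)
    qed (simp add: Y_def cm)
    show ?thesis unfolding A Y D using False by (simp add: extension_count_def s_def K_def)
  qed
qed

text \<open>A placement of the larger set is a placement of \<open>I\<close> with an allowed image
  of \<open>i\<close>, and each placement of \<open>I\<close> has the same number of these.\<close>

lemma card_typed_placements_insert: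
  assumes cls: "two_sized_classes X h ty m a b" and fin: "finite I" "i \<notin> I"
  shows "of_nat (card (typed_placements X h ty j B (insert i I))) =
    of_nat (card (typed_placements X h ty j B I)) * extension_count (card X) b j B I i (of_nat m) (of_nat a)"
proof -
  define al where "al \<tau> = {x \<in> X. x \<notin> \<tau> ` I \<and> (\<forall>i'\<in>I. h x = h (\<tau> i') \<longleftrightarrow> j i = j i') \<and> (ty (h x) \<longleftrightarrow> j i \<in> B)}" for \<tau>
  let ?T = "typed_placements X h ty j B"
  have finX: "finite X" using cls by (simp add: two_sized_classes_def)
  have finT: "finite (?T I)"
    using finite_PiE[OF fin(1), of "\<lambda>_. X"] finX unfolding typed_placements_def by simp
  have "bij_betw (\<lambda>(\<tau>, x). \<tau>(i := x)) (Sigma (?T I) al) (?T (insert i I))"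
  proof (rule bij_betw_byWitness[where f' = "\<lambda>\<tau>. (restrict \<tau> I, \<tau> i)"])
    show "\<forall>p\<in>Sigma (?T I) al. (restrict ((\<lambda>(\<tau>, x). \<tau>(i := x)) p) I, ((\<lambda>(\<tau>, x). \<tau>(i := x)) p) i) = p"
    proof (intro ballI)
      fix p assume p: "p \<in> Sigma (?T I) al"
      obtain \<tau> x where \<tau>: "p = (\<tau>, x)" "\<tau> \<in> ?T I" using p by blast
      have "restrict (\<tau>(i := x)) I = \<tau>"
        using fin \<tau>(2) by (auto simp: typed_placements_def fun_eq_iff PiE_def extensional_def)
      then show "(restrict ((\<lambda>(\<tau>, x). \<tau>(i := x)) p) I, ((\<lambda>(\<tau>, x). \<tau>(i := x)) p) i) = p"
        by (simp add: \<tau>(1))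
    qed
    show "\<forall>\<tau>\<in>?T (insert i I). (\<lambda>(\<tau>, x). \<tau>(i := x)) (restrict \<tau> I, \<tau> i) = \<tau>"
      using fin by (auto simp: typed_placements_def fun_eq_iff PiE_def extensional_def)
    show "(\<lambda>(\<tau>, x). \<tau>(i := x)) ` Sigma (?T I) al \<subseteq> ?T (insert i I)"
    proof clarify
      fix \<tau> x assume \<tau>: "\<tau> \<in> ?T I" and x: "x \<in> al \<tau>"
      have upd: "(\<tau>(i := x)) k = \<tau> k" if "k \<in> I" for k using that fin by auto
      have P: "\<tau> \<in> I \<rightarrow>\<^sub>E X" "inj_on \<tau> I"
        and ker: "\<And>k k'. k \<in> I \<Longrightarrow> k' \<in> I \<Longrightarrow> h (\<tau> k) = h (\<tau> k') \<longleftrightarrow> j k = j k'"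
        and ty: "\<And>k. k \<in> I \<Longrightarrow> ty (h (\<tau> k)) \<longleftrightarrow> j k \<in> B"
        using \<tau> by (simp_all add: typed_placements_def)
      have xs: "x \<in> X" "x \<notin> \<tau> ` I" "ty (h x) \<longleftrightarrow> j i \<in> B"
        and xker: "\<And>k. k \<in> I \<Longrightarrow> h x = h (\<tau> k) \<longleftrightarrow> j i = j k"
        using x by (simp_all add: al_def)
      have "\<tau>(i := x) \<in> insert i I \<rightarrow>\<^sub>E X"
        using P(1) xs(1) by (auto simp: PiE_def extensional_def)
      moreover have "inj_on (\<tau>(i := x)) (insert i I)"
        using P(2) xs(2) fin(2) by (auto simp: inj_on_def)
      moreover have "h ((\<tau>(i := x)) k) = h ((\<tau>(i := x)) k') \<longleftrightarrow> j k = j k'"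
        if "k \<in> insert i I" "k' \<in> insert i I" for k k'
      proof -
        consider "k = i" "k' = i" | "k = i" "k' \<in> I" | "k \<in> I" "k' = i" | "k \<in> I" "k' \<in> I"
          using \<open>k \<in> insert i I\<close> \<open>k' \<in> insert i I\<close> by blast
        then show ?thesis
        proof cases
          case 2
          then show ?thesis using xker[of k'] by (simp only: upd fun_upd_same)
        next
          case 3
          then show ?thesis using xker[of k] by (simp only: upd fun_upd_same) metis
        next
          case 4
          then show ?thesis using ker[of k k'] by (simp only: upd)
        qed simp
      qed
      moreover have "ty (h ((\<tau>(i := x)) k)) \<longleftrightarrow> j k \<in> B" if "k \<in> insert i I" for k
        using that xs(3) ty upd by (metis fun_upd_same insertE)
      ultimately show "\<tau>(i := x) \<in> ?T (insert i I)" by (simp only: typed_placements_def) blast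
    qed
    show "(\<lambda>\<tau>. (restrict \<tau> I, \<tau> i)) ` ?T (insert i I) \<subseteq> Sigma (?T I) al"
    proof (rule image_subsetI)
      fix \<tau> assume \<tau>: "\<tau> \<in> ?T (insert i I)"
      have P: "\<tau> \<in> insert i I \<rightarrow>\<^sub>E X" "inj_on \<tau> (insert i I)"
        and ker: "\<And>k k'. k \<in> insert i I \<Longrightarrow> k' \<in> insert i I \<Longrightarrow> h (\<tau> k) = h (\<tau> k') \<longleftrightarrow> j k = j k'"
        and ty: "\<And>k. k \<in> insert i I \<Longrightarrow> ty (h (\<tau> k)) \<longleftrightarrow> j k \<in> B"
        using \<tau> unfolding typed_placements_def by blast+
      have res: "restrict \<tau> I k = \<tau> k" if "k \<in> I" for k using that by simp
      have "restrict \<tau> I \<in> I \<rightarrow>\<^sub>E X" using P(1) by auto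
      moreover have "inj_on (restrict \<tau> I) I" using P(2) by (simp add: inj_on_restrict_eq)
      moreover have "\<forall>k\<in>I. \<forall>k'\<in>I. h (restrict \<tau> I k) = h (restrict \<tau> I k') \<longleftrightarrow> j k = j k'"
        using ker by (simp add: res)
      moreover have "\<forall>k\<in>I. ty (h (restrict \<tau> I k)) \<longleftrightarrow> j k \<in> B" using ty by (simp add: res)
      ultimately have "restrict \<tau> I \<in> ?T I" by (simp only: typed_placements_def) blast
      moreover have "\<tau> i \<in> al (restrict \<tau> I)"
      proof -
        have "\<tau> i \<in> X" using P(1) by auto
        moreover have "\<tau> i \<notin> restrict \<tau> I ` I" using P(2) fin(2) by (auto simp: inj_on_def)
        ultimately show ?thesis using ker[of i] ty[of i] by (simp add: al_def)
      qed
      ultimately show "(restrict \<tau> I, \<tau> i) \<in> Sigma (?T I) al" by simp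
    qed
  qed
  then have "card (?T (insert i I)) = card (Sigma (?T I) al)" by (metis bij_betw_same_card)
  also have "\<dots> = (\<Sum>\<tau>\<in>?T I. card (al \<tau>))"
    using finT finX by (intro card_SigmaI) (auto simp: al_def)
  finally have "of_nat (card (?T (insert i I))) = (\<Sum>\<tau>\<in>?T I. of_nat (card (al \<tau>)) :: complex)" by simp
  also have "\<dots> = (\<Sum>\<tau>\<in>?T I. extension_count (card X) b j B I i (of_nat m) (of_nat a))"
    unfolding al_def by (intro sum.cong refl card_allowed_extensions[OF cls _ fin(1)])
  finally show ?thesis by simp
qed

text \<open>Each index contributes one factor of degree at most one in each variable.
  \<open>R\<close> is chosen before the colouring, so one function serves all colourings of
  \<open>V\<close> points.\<close>

lemma card_typed_placements_bipoly:
  assumes "finite I"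
  shows "\<exists>R. bipoly (card I) R \<and> (\<forall>(X :: nat set) (h :: nat \<Rightarrow> nat) ty m a. card X = V \<longrightarrow> two_sized_classes X h ty m a b \<longrightarrow>
    of_nat (card (typed_placements X h ty j B I)) = R (of_nat m) (of_nat a))"
  using assms
proof induction
  case empty
  show ?case by (intro exI[of _ "\<lambda>m a. 1"]) (simp add: bipoly_const typed_placements_def)
next
  case (insert i I)
  then obtain R where R: "bipoly (card I) R"
    "\<And>(X :: nat set) (h :: nat \<Rightarrow> nat) ty m a. card X = V \<Longrightarrow> two_sized_classes X h ty m a b \<Longrightarrow>
      of_nat (card (typed_placements X h ty j B I)) = R (of_nat m) (of_nat a)"
    by blast
  have "bipoly (card (insert i I)) (\<lambda>m a. R m a * extension_count V b j B I i m a)"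
    using bipoly_mult[OF R(1) bipoly_extension_count] insert by simp
  moreover have "of_nat (card (typed_placements X h ty j B (insert i I))) =
      R (of_nat m) (of_nat a) * extension_count V b j B I i (of_nat m) (of_nat a)"
    if "card X = V" "two_sized_classes X h ty m a b" for X :: "nat set" and h :: "nat \<Rightarrow> nat" and ty m a
    using card_typed_placements_insert[OF that(2) insert(1,2), of j B] R(2)[OF that] that(1) by (simp only:)
  ultimately show ?case by (intro exI[of _ "\<lambda>m a. R m a * extension_count V b j B I i m a"]) blast
qed

text \<open>Sums over the possible sets of blocks that land in classes of the first type.\<close>

lemma card_placements_bipoly:
  assumes "finite I"
  shows "\<exists>R. bipoly (card I) R \<and> (\<forall>(X :: nat set) (h :: nat \<Rightarrow> nat) ty m a. card X = V \<longrightarrow> two_sized_classes X h ty m a b \<longrightarrow>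
    of_nat (card {\<tau> \<in> I \<rightarrow>\<^sub>E X. inj_on \<tau> I \<and> (\<forall>i\<in>I. \<forall>i'\<in>I. h (\<tau> i) = h (\<tau> i') \<longleftrightarrow> j i = j i')})
      = R (of_nat m) (of_nat a))"
proof -
  obtain R where R: "\<And>B. bipoly (card I) (R B)"
    "\<And>B (X :: nat set) (h :: nat \<Rightarrow> nat) ty m a. card X = V \<Longrightarrow> two_sized_classes X h ty m a b \<Longrightarrow>
      of_nat (card (typed_placements X h ty j B I)) = R B (of_nat m) (of_nat a)"
    using card_typed_placements_bipoly[OF assms, of V b j] by metis
  have "of_nat (card {\<tau> \<in> I \<rightarrow>\<^sub>E X. inj_on \<tau> I \<and> (\<forall>i\<in>I. \<forall>i'\<in>I. h (\<tau> i) = h (\<tau> i') \<longleftrightarrow> j i = j i')}) =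
      (\<Sum>B\<in>Pow (j ` I). R B (of_nat m) (of_nat a))" (is "of_nat (card ?T) = _")
    if X: "card X = V" "two_sized_classes X h ty m a b" for X :: "nat set" and h :: "nat \<Rightarrow> nat" and ty m a
  proof -
    define blk where "blk \<tau> = j ` {i \<in> I. ty (h (\<tau> i))}" for \<tau>
    have finX: "finite X" using X by (simp add: two_sized_classes_def)
    have "finite ?T" using finite_PiE[OF assms, of "\<lambda>_. X"] finX by simp
    moreover have "blk ` ?T \<subseteq> Pow (j ` I)" by (rule image_subsetI) (unfold blk_def, blast)
    ultimately have "(\<Sum>B\<in>Pow (j ` I). \<Sum>\<tau>\<in>{\<tau> \<in> ?T. blk \<tau> = B}. 1 :: nat) = (\<Sum>\<tau>\<in>?T. 1)"
      using assms by (intro sum.group) simp_all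
    then have "card ?T = (\<Sum>B\<in>Pow (j ` I). card {\<tau> \<in> ?T. blk \<tau> = B})"
      by (simp only: card_eq_sum)
    also have "\<dots> = (\<Sum>B\<in>Pow (j ` I). card (typed_placements X h ty j B I))"
    proof (rule sum.cong)
      fix B assume B: "B \<in> Pow (j ` I)"
      have "blk \<tau> = B \<longleftrightarrow> (\<forall>i\<in>I. ty (h (\<tau> i)) \<longleftrightarrow> j i \<in> B)" if \<tau>: "\<tau> \<in> ?T" for \<tau>
      proof
        assume eq: "blk \<tau> = B"
        show "\<forall>i\<in>I. ty (h (\<tau> i)) \<longleftrightarrow> j i \<in> B"
        proof (intro ballI iffI)
          fix i assume i: "i \<in> I"
          show "j i \<in> B" if "ty (h (\<tau> i))" using that i unfolding eq[symmetric] blk_def by blast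
          \<comment> \<open>Points of one block share a colour and hence a type.\<close>
          show "ty (h (\<tau> i))" if jB: "j i \<in> B"
          proof -
            obtain i' where i': "i' \<in> I" "ty (h (\<tau> i'))" "j i = j i'"
              using jB unfolding eq[symmetric] blk_def by blast
            then have "h (\<tau> i) = h (\<tau> i')" using \<tau> i by blast
            then show ?thesis using i' by simp
          qed
        qed
      next
        assume "\<forall>i\<in>I. ty (h (\<tau> i)) \<longleftrightarrow> j i \<in> B"
        then show "blk \<tau> = B" using B unfolding blk_def by blast
      qed
      then have "{\<tau> \<in> ?T. blk \<tau> = B} = typed_placements X h ty j B I"
        unfolding typed_placements_def by blast
      then show "card {\<tau> \<in> ?T. blk \<tau> = B} = card (typed_placements X h ty j B I)" by simp
    qed simp
    finally show ?thesis by (simp add: R(2)[OF X])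
  qed
  moreover have "bipoly (card I) (\<lambda>m a. \<Sum>B\<in>Pow (j ` I). R B m a)" by (intro bipoly_sum R)
  ultimately show ?thesis by blast
qed

section \<open>The lower bounds\<close>

text \<open>Generic in the field: complex for query polynomials, real for probabilities.\<close>

definition sampled_average ::
  "nat \<Rightarrow> nat \<Rightarrow> nat \<Rightarrow> ((nat \<Rightarrow> nat) \<Rightarrow> 'a::real_normed_field) \<Rightarrow> (nat \<Rightarrow> nat) \<Rightarrow> 'a" where
  "sampled_average n M V F h =
     (\<Sum>\<sigma> | \<sigma> permutes {1..V}. \<Sum>\<pi> | \<pi> permutes {1..M}. F (sample n M (h \<circ> \<sigma>) \<pi>)) / (fact V * fact M)"

lemma sampled_average_monomial:
  assumes "n \<le> M" "n \<le> V" "S \<subseteq> {1..n} \<times> {1..M}"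
  shows "sampled_average n M V (\<lambda>f. c * monomial S f) h =
    c * of_nat (stabilizer_card {1..M} (snd ` S)) * of_nat (stabilizer_card {1..V} (fst ` S)) / (fact V * fact M) *
    of_nat (card {\<tau> \<in> fst ` S \<rightarrow>\<^sub>E {1..V}. inj_on \<tau> (fst ` S) \<and> same_kernel S (h \<circ> \<tau>)})"
proof -
  have "fst ` S \<subseteq> {1..V}" using assms by auto
  then have "(\<Sum>\<sigma> | \<sigma> permutes {1..V}. \<Sum>\<pi> | \<pi> permutes {1..M}. c * monomial S (sample n M (h \<circ> \<sigma>) \<pi>)) =
    c * (of_nat (stabilizer_card {1..M} (snd ` S)) * of_nat (stabilizer_card {1..V} (fst ` S) *
      card {\<tau> \<in> fst ` S \<rightarrow>\<^sub>E {1..V}. inj_on \<tau> (fst ` S) \<and> same_kernel S (h \<circ> \<tau>)}))"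
    by (simp only: sum_distrib_left[symmetric] sum_monomial_sample[OF assms(1,3)]
        sum_same_kernel_permutes[OF finite_atLeastAtMost])
  then show ?thesis by (simp add: sampled_average_def)
qed

text \<open>The function \<open>R\<close> does not depend on the type predicate \<open>ty\<close>: exchanging the two types of classes
  relates the functions for different \<open>b\<close>.\<close>

lemma sampled_average_bipoly:
  assumes "query_poly n M d F" and nM: "n \<le> M" and nV: "n \<le> V"
  shows "\<exists>R. bipoly d R \<and> (\<forall>h ty m a. two_sized_classes {1..V} h ty m a b \<longrightarrow>
    sampled_average n M V F h = R (of_nat m) (of_nat a))"
  using assms(1)
proof induction
  case (monom S c)
  define K where "K = c * of_nat (stabilizer_card {1..M} (snd ` S)) * of_nat (stabilizer_card {1..V} (fst ` S)) / (fact V * fact M)"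
  note avg = sampled_average_monomial[OF nM nV monom(1), of c, folded K_def]
  have finS: "finite S" using finite_subset[OF monom(1)] by simp
  show ?case
  \<comment> \<open>Either \<open>S\<close> is the graph of a function, read off as
    \<open>j\<close>, or it is contradictory and its average vanishes.\<close>
  proof (cases "\<forall>i y y'. (i, y) \<in> S \<longrightarrow> (i, y') \<in> S \<longrightarrow> y = y'")
    case True
    define j where "j i = (SOME y. (i, y) \<in> S)" for i
    have j: "j (fst x) = snd x" if "x \<in> S" for x
    proof -
      have "(fst x, j (fst x)) \<in> S" unfolding j_def using that someI[of "\<lambda>y. (fst x, y) \<in> S" "snd x"] by simp
      moreover have "(fst x, snd x) \<in> S" using that by simp
      ultimately show ?thesis using True by blast
    qed
    have ker: "same_kernel S (h \<circ> \<tau>) \<longleftrightarrow> (\<forall>i\<in>fst ` S. \<forall>i'\<in>fst ` S. h (\<tau> i) = h (\<tau> i') \<longleftrightarrow> j i = j i')"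
      for h :: "nat \<Rightarrow> nat" and \<tau> :: "nat \<Rightarrow> nat"
      by (simp add: same_kernel_def split_def j)
    obtain R where R: "bipoly (card (fst ` S)) R" "\<And>(X :: nat set) (h :: nat \<Rightarrow> nat) ty m a. card X = V \<Longrightarrow>
        two_sized_classes X h ty m a b \<Longrightarrow>
        of_nat (card {\<tau> \<in> fst ` S \<rightarrow>\<^sub>E X. inj_on \<tau> (fst ` S) \<and> (\<forall>i\<in>fst ` S. \<forall>i'\<in>fst ` S. h (\<tau> i) = h (\<tau> i') \<longleftrightarrow> j i = j i')})
          = R (of_nat m) (of_nat a)"
      using card_placements_bipoly[of "fst ` S" V b j] finS by blast
    have "card (fst ` S) \<le> d" using card_image_le[OF finS, of fst] monom(2) by simp
    then have "bipoly d (\<lambda>m a. K * R m a)" by (rule bipoly_cmult[OF bipoly_mono[OF R(1)]])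
    moreover have "sampled_average n M V (\<lambda>f. c * monomial S f) h = K * R (of_nat m) (of_nat a)"
      if "two_sized_classes {1..V} h ty m a b" for h ty m a
      unfolding avg ker by (subst R(2)[OF _ that]) simp_all
    ultimately show ?thesis by blast
  next
    case False
    then obtain i y y' where "(i, y) \<in> S" "(i, y') \<in> S" "y \<noteq> y'" by blast
    then have "\<not> same_kernel S g" for g using same_kernelD[of S g i y i y'] by blast
    then have "sampled_average n M V (\<lambda>f. c * monomial S f) h = 0" for h unfolding avg by simp
    then show ?thesis by (intro exI[of _ "\<lambda>m a. 0"]) (simp add: bipoly_const)
  qed
next
  case (add F G)
  then obtain R R' where R: "bipoly d R" "bipoly d R'"
    "\<And>h ty m a. two_sized_classes {1..V} h ty m a b \<Longrightarrow> sampled_average n M V F h = R (of_nat m) (of_nat a)"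
    "\<And>h ty m a. two_sized_classes {1..V} h ty m a b \<Longrightarrow> sampled_average n M V G h = R' (of_nat m) (of_nat a)"
    by blast
  have "sampled_average n M V (\<lambda>f. F f + G f) h = sampled_average n M V F h + sampled_average n M V G h" for h
    by (simp add: sampled_average_def sum.distrib add_divide_distrib)
  then show ?case
    by (intro exI[of _ "\<lambda>m a. R m a + R' m a"]) (auto intro: bipoly_add R simp: R(3,4))
qed

lemma sampled_average_of_real:
  assumes "n \<le> M" "\<And>f. f \<in> function_space n M \<Longrightarrow> F f = of_real (P f)"
  shows "sampled_average n M V F h = of_real (sampled_average n M V P h)"
proof -
  have "F (sample n M g \<pi>) = of_real (P (sample n M g \<pi>))" if "\<pi> permutes {1..M}" for g \<pi>
    using assms sample_in_function_space that by blast
  then show ?thesis by (simp add: sampled_average_def)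
qed

text \<open>The bound may depend on \<open>\<sigma>\<close>, because the chosen points alone decide
  whether a sample has a collision.\<close>

lemma sampled_average_le:
  fixes P :: "(nat \<Rightarrow> nat) \<Rightarrow> real"
  assumes "\<And>\<sigma> \<pi>. \<sigma> permutes {1..V} \<Longrightarrow> \<pi> permutes {1..M} \<Longrightarrow> P (sample n M (h \<circ> \<sigma>) \<pi>) \<le> u \<sigma>"
  shows "sampled_average n M V P h \<le> (\<Sum>\<sigma> | \<sigma> permutes {1..V}. u \<sigma>) / fact V"
proof -
  have "(\<Sum>\<sigma> | \<sigma> permutes {1..V}. \<Sum>\<pi> | \<pi> permutes {1..M}. P (sample n M (h \<circ> \<sigma>) \<pi>)) \<le>
      (\<Sum>\<sigma> | \<sigma> permutes {1..V}. \<Sum>\<pi> | \<pi> permutes {1..M}. u \<sigma>)"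
    using assms by (intro sum_mono) auto
  also have "\<dots> = (\<Sum>\<sigma> | \<sigma> permutes {1..V}. u \<sigma>) * fact M"
    using card_permutations[of "{1..M}" M] by (simp add: sum_distrib_left mult.commute)
  finally show ?thesis by (simp add: sampled_average_def field_simps)
qed

lemma sampled_average_ge:
  fixes P :: "(nat \<Rightarrow> nat) \<Rightarrow> real"
  assumes "\<And>\<sigma> \<pi>. \<sigma> permutes {1..V} \<Longrightarrow> \<pi> permutes {1..M} \<Longrightarrow> l \<le> P (sample n M (h \<circ> \<sigma>) \<pi>)"
  shows "l \<le> sampled_average n M V P h"
proof -
  have "sampled_average n M V (\<lambda>f. - P f) h \<le> (\<Sum>\<sigma> | \<sigma> permutes {1..V}. - l) / fact V"
    by (rule sampled_average_le) (use assms in auto)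
  then show ?thesis
    using card_permutations[of "{1..V}" V] by (simp add: sampled_average_def sum_negf)
qed

section \<open>Existence of the colourings and the gap argument\<close>

text \<open>The points after \<open>s\<close> are numbered from 0 and cut into blocks of length
  \<open>a\<close>; divisibility makes the last block full.\<close>

lemma block_of_division:
  fixes a m s x :: nat
  assumes "a dvd m" "0 < a" "x \<in> {s<..s + m}"
  shows "card {y \<in> {s<..s + m}. (y - 1 - s) div a = (x - 1 - s) div a} = a"
proof -
  define q where "q = (x - 1 - s) div a"
  obtain k where k: "m = a * k" using assms(1) by blast
  have "x - 1 - s < k * a" using assms(3) by (auto simp: k mult.commute)
  then have "q < k" unfolding q_def by (rule less_mult_imp_div_less)
  then have "a * Suc q \<le> m" unfolding k by (intro mult_left_mono) auto
  then have qm: "a * q + a \<le> m" by simp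
  have "{y \<in> {s<..s + m}. (y - 1 - s) div a = q} = {s + a * q<..s + a * q + a}"
  proof (intro set_eqI iffI)
    fix y assume y: "y \<in> {y \<in> {s<..s + m}. (y - 1 - s) div a = q}"
    define r where "r = (y - 1 - s) mod a"
    have "(y - 1 - s) div a = q" using y by simp
    then have "y - 1 - s = a * q + r" unfolding r_def by (metis mult_div_mod_eq)
    moreover have "r < a" using assms(2) by (simp add: r_def)
    ultimately show "y \<in> {s + a * q<..s + a * q + a}" using y by auto
  next
    fix y assume y: "y \<in> {s + a * q<..s + a * q + a}"
    then have "a * q \<le> y - 1 - s" "y - 1 - s < a * Suc q" by auto
    then have "(y - 1 - s) div a = q" by (intro div_nat_eqI) (simp_all add: mult.commute)
    then show "y \<in> {y \<in> {s<..s + m}. (y - 1 - s) div a = q}" using y qm by auto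
  qed
  then show ?thesis by (simp add: q_def)
qed

lemma ex_two_sized_classes:
  assumes "0 < a" "a dvd m" "0 < b" "b dvd V - m" "m \<le> V"
  shows "\<exists>h :: nat \<Rightarrow> nat. two_sized_classes {1..V} h even m a b"
proof -
  \<comment> \<open>Parity is the type: even colours cut the first \<open>m\<close> points into
    blocks of \<open>a\<close>, odd colours the rest into blocks of \<open>b\<close>.\<close>
  define h where "h x = (if x \<le> m then 2 * ((x - 1 - 0) div a) else 2 * ((x - 1 - m) div b) + 1)" for x
  have ev: "even (h x) \<longleftrightarrow> x \<le> m" for x by (simp add: h_def)
  have "{x \<in> {1..V}. even (h x)} = {1..m}" using assms by (auto simp: ev)
  then have "card {x \<in> {1..V}. even (h x)} = m" by simp
  moreover have "card {y \<in> {1..V}. h y = h x} = (if even (h x) then a else b)" if x: "x \<in> {1..V}" for x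
  proof (cases "x \<le> m")
    case True
    have same: "h y = h x \<longleftrightarrow> y \<le> m \<and> (y - 1 - 0) div a = (x - 1 - 0) div a" for y
    proof (cases "y \<le> m")
      case False
      then have "h y \<noteq> h x" using ev True by metis
      then show ?thesis using False by simp
    qed (use True in \<open>simp add: h_def\<close>)
    have "{y \<in> {1..V}. h y = h x} = {y \<in> {0<..0 + m}. (y - 1 - 0) div a = (x - 1 - 0) div a}"
      unfolding same using assms(5) by auto
    then show ?thesis using block_of_division[OF assms(2,1), of x 0] True x ev by simp
  next
    case False
    have same: "h y = h x \<longleftrightarrow> m < y \<and> (y - 1 - m) div b = (x - 1 - m) div b" for y
    proof (cases "y \<le> m")
      case True
      then have "h y \<noteq> h x" using ev False by metis
      then show ?thesis using True by simp
    qed (use False in \<open>simp add: h_def\<close>)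
    have "{y \<in> {1..V}. h y = h x} = {y \<in> {m<..m + (V - m)}. (y - 1 - m) div b = (x - 1 - m) div b}"
      unfolding same using assms(5) by auto
    then show ?thesis using block_of_division[OF assms(4,3), of x m] False x ev assms(5) by simp
  qed
  ultimately show ?thesis unfolding two_sized_classes_def by blast
qed

text \<open>Reads the same colouring with the other class size as the variable one.\<close>

lemma two_sized_classes_swap:
  assumes "two_sized_classes X h ty m a b"
  shows "two_sized_classes X h (\<lambda>c. \<not> ty c) (card X - m) b a"
proof -
  have "{x \<in> X. \<not> ty (h x)} = X - {x \<in> X. ty (h x)}" by auto
  then show ?thesis using assms unfolding two_sized_classes_def by (simp add: card_Diff_subset)
qed

text \<open>The drop of 2\<delta> between all classes of size 1 and all of size 2 passes through a
  mixed colouring, so one of the two stages drops by \<delta>. Within a stage one class size stays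
  fixed, and both averages are values of one function.\<close>

lemma degree_bound_of_average_gap:
  fixes P :: "(nat \<Rightarrow> nat) \<Rightarrow> real" and c d V :: nat
  assumes F: "query_poly n M d F" "\<And>f. f \<in> function_space n M \<Longrightarrow> F f = of_real (P f)"
    and P01: "\<And>f. f \<in> function_space n M \<Longrightarrow> 0 \<le> P f \<and> P f \<le> 1"
    and nM: "n \<le> M" and nV: "n \<le> V" and V: "even V" "4 \<le> V"
    and inj: "\<And>h. inj_on h {1..V} \<Longrightarrow> hi \<le> sampled_average n M V P h"
    and two: "\<And>h. (\<And>x. x \<in> {1..V} \<Longrightarrow> card {y \<in> {1..V}. h y = h x} = 2) \<Longrightarrow> sampled_average n M V P h \<le> lo"
    and gap: "2 * \<delta> \<le> hi - lo" "0 < \<delta>" and c: "144 < \<delta> * c" "2 \<le> c"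
  shows "V < 16 * (2 + c) * d ^ 3"
proof -
  define av where "av = sampled_average n M V P"
  have av: "sampled_average n M V F h = of_real (av h)" for h
    unfolding av_def by (rule sampled_average_of_real[OF nM F(2)])
  have av01: "0 \<le> av h \<and> av h \<le> 1" for h
  proof -
    have "av h \<le> (\<Sum>\<sigma> | \<sigma> permutes {1..V}. 1) / fact V"
      unfolding av_def using P01 sample_in_function_space[OF nM] by (intro sampled_average_le) blast
    moreover have "0 \<le> av h"
      unfolding av_def using P01 sample_in_function_space[OF nM] by (intro sampled_average_ge) blast
    ultimately show ?thesis using card_permutations[of "{1..V}" V] by simp
  qed
  obtain R where R: "\<And>b. bipoly d (R b)" "\<And>b h ty m a. two_sized_classes {1..V} h ty m a b \<Longrightarrow>
      of_real (av h) = R b (of_nat m) (of_nat a)"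
    using sampled_average_bipoly[OF F(1) nM nV] unfolding av by metis
  have bd: "cmod (R b (of_nat m) (of_nat a)) \<le> 1"
    if ab: "b \<in> {1, 2}" "1 \<le> a" "2 * a dvd m" "m \<le> V" for a b m
  proof -
    have "even m" "a dvd m" using ab(3) dvd_mult_left dvd_mult_right by blast+
    \<comment> \<open>\<open>V\<close> and \<open>m\<close> are both even, which suffices for b = 1
      and b = 2.\<close>
    then have "b dvd V - m" using V ab by auto
    then obtain h :: "nat \<Rightarrow> nat" where "two_sized_classes {1..V} h even m a b"
      using ex_two_sized_classes[of a m b V] ab \<open>a dvd m\<close> by auto
    then have "R b (of_nat m) (of_nat a) = of_real (av h)" using R(2) by metis
    then show ?thesis using av01[of h] by simp
  qed
  \<comment> \<open>Both parts are even, as pairs require, and at least a quarter of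
    \<open>V\<close>, so that \<open>m\<close> and \<open>V - m\<close> lie far from the
    ends.\<close>
  define m where "m = 2 * (V div 4)"
  have m: "even m" "m \<le> V" "V \<le> 4 * m" "V \<le> 4 * (V - m)" "V - (V - m) = m" "even (V - m)"
    using V unfolding m_def by presburger+
  obtain h11 :: "nat \<Rightarrow> nat" where h11: "two_sized_classes {1..V} h11 even (V - m) 1 1"
    using ex_two_sized_classes[of 1 "V - m" 1 V] by auto
  obtain h22 :: "nat \<Rightarrow> nat" where h22: "two_sized_classes {1..V} h22 even m 2 2"
    using ex_two_sized_classes[of 2 m 2 V] m by auto
  obtain h12 :: "nat \<Rightarrow> nat" where h12: "two_sized_classes {1..V} h12 even m 1 2"
    using ex_two_sized_classes[of 1 m 2 V] m by auto
  \<comment> \<open>The mixed colouring gives a value of \<open>R 2\<close> at \<open>m\<close> and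
    one of \<open>R 1\<close> at \<open>V - m\<close>; \<open>h11\<close> is therefore read with
    \<open>V - m\<close> points.\<close>
  have h21: "two_sized_classes {1..V} h12 (\<lambda>c. \<not> even c) (V - m) 2 1"
    using two_sized_classes_swap[OF h12] by simp
  have "hi \<le> av h11"
    unfolding av_def
  proof (rule inj, rule inj_onI)
    fix x y assume xy: "x \<in> {1..V}" "y \<in> {1..V}" "h11 x = h11 y"
    have "card {z \<in> {1..V}. h11 z = h11 x} = 1" using h11 xy(1) unfolding two_sized_classes_def by simp
    then obtain z where z: "{z \<in> {1..V}. h11 z = h11 x} = {z}" by (rule card_1_singletonE)
    have "x \<in> {z \<in> {1..V}. h11 z = h11 x}" "y \<in> {z \<in> {1..V}. h11 z = h11 x}" using xy by simp_all
    then show "x = y" unfolding z by simp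
  qed
  moreover have "av h22 \<le> lo"
    unfolding av_def by (rule two) (use h22 in \<open>simp add: two_sized_classes_def\<close>)
  ultimately consider "\<delta> \<le> av h12 - av h22" | "\<delta> \<le> av h11 - av h12"
    using gap by argo
  then show ?thesis
  proof cases
    case 1
    have eq: "R 2 (of_nat m) 1 - R 2 (of_nat m) 2 = of_real (av h12 - av h22)"
      using R(2)[OF h12] R(2)[OF h22] by simp
    show ?thesis
    proof (rule sections_gap_imp_degree[where R = "R 2" and ?m0.0 = m and \<delta> = \<delta>])
      show "\<delta> \<le> cmod (R 2 (of_nat m) 1 - R 2 (of_nat m) 2)" unfolding eq norm_of_real using 1 by linarith
    qed (use R(1)[of 2, unfolded bipoly_def] bd[of 2] gap c m in auto)
  next
    case 2
    have eq: "R 1 (of_nat (V - m)) 1 - R 1 (of_nat (V - m)) 2 = of_real (av h11 - av h12)"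
      using R(2)[OF h11] R(2)[OF h21] by simp
    show ?thesis
    proof (rule sections_gap_imp_degree[where R = "R 1" and ?m0.0 = "V - m" and \<delta> = \<delta>])
      show "\<delta> \<le> cmod (R 1 (of_nat (V - m)) 1 - R 1 (of_nat (V - m)) 2)" unfolding eq norm_of_real using 2 by linarith
    qed (use R(1)[of 1, unfolded bipoly_def] bd[of 1] gap c m in auto)
  qed
qed

section \<open>The birthday estimate\<close>

text \<open>With a single type and the identity as pattern, each index opens a new class, and the i
  earlier classes block r i points.\<close>

lemma card_collision_free_placements:
  fixes X :: "nat set" and h :: "nat \<Rightarrow> nat"
  assumes X: "finite X" "\<And>x. x \<in> X \<Longrightarrow> card {y \<in> X. h y = h x} = r"
  shows "(of_nat (card {\<tau> \<in> {1..k} \<rightarrow>\<^sub>E X. inj_on \<tau> {1..k} \<and> (\<forall>i\<in>{1..k}. \<forall>i'\<in>{1..k}. h (\<tau> i) = h (\<tau> i') \<longleftrightarrow> i = i')}) :: complex) =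
    (\<Prod>i<k. of_nat (card X) - of_nat r * of_nat i)"
proof -
  have cls: "two_sized_classes X h (\<lambda>_. True) (card X) r 0"
    using X by (simp add: two_sized_classes_def)
  have "(of_nat (card (typed_placements X h (\<lambda>_. True) (\<lambda>i. i) UNIV {1..k})) :: complex) =
      (\<Prod>i<k. of_nat (card X) - of_nat r * of_nat i)" for k :: nat
  proof (induction k)
    case 0
    show ?case by (simp add: typed_placements_def)
  next
    case (Suc k)
    have ins: "{1..Suc k} = insert (Suc k) {1..k}" by auto
    have "{i' \<in> {1..k}. i' \<in> UNIV \<longleftrightarrow> Suc k \<in> UNIV} = {1..k}" by auto
    then have "extension_count (card X) 0 (\<lambda>i. i) UNIV {1..k} (Suc k) (of_nat (card X)) (of_nat r) =
        of_nat (card X) - of_nat r * of_nat k"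
      by (simp only: extension_count_def image_ident) simp
    then show ?case unfolding ins prod.lessThan_Suc Suc[symmetric]
      by (subst card_typed_placements_insert[OF cls]) simp_all
  qed
  then show ?thesis by (simp add: typed_placements_def)
qed

text \<open>Dividing by the same count for the identity colouring cancels the stabilizer. What
  remains is a product of factors (V - 2i)/(V - i), each at most exp(-i/V).\<close>

lemma collision_free_fraction:
  fixes h :: "nat \<Rightarrow> nat"
  assumes two: "\<And>x. x \<in> {1..V} \<Longrightarrow> card {y \<in> {1..V}. h y = h x} = 2" and nV: "2 * n \<le> V" "0 < V"
  shows "real (card {\<sigma>. \<sigma> permutes {1..V} \<and> inj_on (h \<circ> \<sigma>) {1..n}}) / fact V \<le>
    exp (- (real n * (real n - 1) / (2 * V)))"
proof -
  \<comment> \<open>Matching the diagonal pattern means that all \<open>n\<close> values are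
    distinct.\<close>
  define S :: "(nat \<times> nat) set" where "S = (\<lambda>i. (i, i)) ` {1..n}"
  define s where "s = stabilizer_card {1..V} {1..n}"
  have fstS: "fst ` S = {1..n}" by (force simp: S_def)
  have ker: "same_kernel S g \<longleftrightarrow> (\<forall>i\<in>{1..n}. \<forall>i'\<in>{1..n}. g i = g i' \<longleftrightarrow> i = i')" for g :: "nat \<Rightarrow> nat"
    by (simp add: same_kernel_def S_def)
  have count: "(of_nat (card {\<sigma>. \<sigma> permutes {1..V} \<and> (\<forall>i\<in>{1..n}. \<forall>i'\<in>{1..n}. g (\<sigma> i) = g (\<sigma> i') \<longleftrightarrow> i = i')}) :: complex) =
      of_nat s * (\<Prod>i<n. of_nat V - of_nat r * of_nat i)"
    if "\<And>x. x \<in> {1..V} \<Longrightarrow> card {y \<in> {1..V}. g y = g x} = r" for g :: "nat \<Rightarrow> nat" and r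
  proof -
    have "(of_nat (card {\<sigma>. \<sigma> permutes {1..V} \<and> same_kernel S (g \<circ> \<sigma>)}) :: complex) =
        (\<Sum>\<sigma>\<in>{\<sigma>. \<sigma> permutes {1..V} \<and> same_kernel S (g \<circ> \<sigma>)}. 1)" by simp
    also have "\<dots> = (\<Sum>\<sigma> | \<sigma> permutes {1..V}. of_bool (same_kernel S (g \<circ> \<sigma>)))"
      by (rule sum.mono_neutral_cong_left) (auto simp: finite_permutations)
    also have "\<dots> = of_nat (stabilizer_card {1..V} (fst ` S) *
        card {\<tau> \<in> fst ` S \<rightarrow>\<^sub>E {1..V}. inj_on \<tau> (fst ` S) \<and> same_kernel S (g \<circ> \<tau>)})"
      by (rule sum_same_kernel_permutes) (use nV in \<open>auto simp: S_def\<close>)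
    also have "\<dots> = of_nat s * (\<Prod>i<n. of_nat V - of_nat r * of_nat i)"
      using card_collision_free_placements[of "{1..V}" g r n] that unfolding fstS ker s_def by simp
    finally show ?thesis unfolding ker by simp
  qed
  \<comment> \<open>For \<open>id\<close> every permutation is collision-free, so this count is
    V!.\<close>
  have "{\<sigma>. \<sigma> permutes {1..V} \<and> (\<forall>i\<in>{1..n}. \<forall>i'\<in>{1..n}. id (\<sigma> i) = id (\<sigma> i') \<longleftrightarrow> i = i')} = {\<sigma>. \<sigma> permutes {1..V}}"
    by (intro Collect_cong) (auto simp: inj_eq dest: permutes_inj)
  moreover have "card {y \<in> {1..V}. id y = id x} = 1" if "x \<in> {1..V}" for x
  proof -
    have "{y \<in> {1..V}. id y = id x} = {x}" using that by auto
    then show ?thesis by simp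
  qed
  ultimately have all: "complex_of_nat (fact V) = of_nat s * (\<Prod>i<n. of_nat V - of_nat i)"
    using count[of id 1] card_permutations[of "{1..V}" V] by simp
  have "{\<sigma>. \<sigma> permutes {1..V} \<and> inj_on (h \<circ> \<sigma>) {1..n}} =
      {\<sigma>. \<sigma> permutes {1..V} \<and> (\<forall>i\<in>{1..n}. \<forall>i'\<in>{1..n}. h (\<sigma> i) = h (\<sigma> i') \<longleftrightarrow> i = i')}" (is "?Q = ?Q'")
  proof -
    have "inj_on (h \<circ> \<sigma>) {1..n} \<longleftrightarrow> (\<forall>i\<in>{1..n}. \<forall>i'\<in>{1..n}. h (\<sigma> i) = h (\<sigma> i') \<longleftrightarrow> i = i')" for \<sigma>
      unfolding inj_on_def by auto
    then show ?thesis by simp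
  qed
  then have free: "complex_of_nat (card ?Q) = of_nat s * (\<Prod>i<n. of_nat V - 2 * of_nat i)"
    using count[of h 2] two by simp
  have "complex_of_real (fact V) = of_real (real s * (\<Prod>i<n. real V - real i))" using all by simp
  then have all': "fact V = real s * (\<Prod>i<n. real V - real i)" by (simp only: of_real_eq_iff)
  have "complex_of_real (real (card ?Q)) = of_real (real s * (\<Prod>i<n. real V - 2 * real i))" using free by simp
  then have free': "real (card ?Q) = real s * (\<Prod>i<n. real V - 2 * real i)" by (simp only: of_real_eq_iff)
  have "s \<noteq> 0" using all' by (metis fact_nonzero mult_zero_left of_nat_0)
  then have "real (card ?Q) / fact V = (\<Prod>i<n. (real V - 2 * real i) / (real V - real i))"
    unfolding all' free' by (simp add: prod_dividef)
  also have "\<dots> \<le> (\<Prod>i<n. exp (- (real i / V)))"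
  proof (intro prod_mono conjI)
    fix i assume "i \<in> {..<n}"
    then have i: "i < n" by simp
    then have pos: "real V - real i > 0" "real V - 2 * real i \<ge> 0" using nV by linarith+
    then show "0 \<le> (real V - 2 * real i) / (real V - real i)" by simp
    have "(real V - 2 * real i) / (real V - real i) = 1 - real i / (real V - real i)"
      using pos by (simp add: field_simps)
    also have "\<dots> \<le> 1 - real i / V"
      using pos nV by (intro diff_left_mono divide_left_mono) auto
    also have "\<dots> \<le> exp (- (real i / V))" using exp_ge_add_one_self[of "- (real i / V)"] by simp
    finally show "(real V - 2 * real i) / (real V - real i) \<le> exp (- (real i / V))" .
  qed
  also have "\<dots> = exp (- ((\<Sum>i<n. real i) / V))"
    by (simp add: exp_sum[symmetric] sum_negf sum_divide_distrib)
  also have "(\<Sum>i<n. real i) = real n * (real n - 1) / 2"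
    by (induction n) (auto simp: field_simps)
  finally show ?thesis by (simp only: divide_divide_eq_left of_nat_mult of_nat_numeral)
qed

lemma inj_on_sample_iff:
  assumes "n \<le> M" "\<pi> permutes {1..M}"
  shows "inj_on (sample n M g \<pi>) {1..n} \<longleftrightarrow> inj_on g {1..n}"
  unfolding inj_on_def using sample_eq_iff[OF assms, of _ _ g] by (intro ball_cong refl) simp

text \<open>Samples with a collision contribute at most \<open>lo\<close>; the others contribute at
  most their proportion, which the birthday estimate bounds.\<close>

lemma sampled_average_two_to_one_le:
  fixes P :: "(nat \<Rightarrow> nat) \<Rightarrow> real" and h :: "nat \<Rightarrow> nat"
  assumes nM: "n \<le> M" and P1: "\<And>f. f \<in> function_space n M \<Longrightarrow> P f \<le> 1"
    and lo: "\<And>f. f \<in> function_space n M \<Longrightarrow> \<not> inj_on f {1..n} \<Longrightarrow> P f \<le> lo" "0 \<le> lo"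
    and two: "\<And>x. x \<in> {1..V} \<Longrightarrow> card {y \<in> {1..V}. h y = h x} = 2" and nV: "2 * n \<le> V" "0 < V"
  shows "sampled_average n M V P h \<le> lo + exp (- (real n * (real n - 1) / (2 * V)))"
proof -
  define Q where "Q = {\<sigma>. \<sigma> permutes {1..V} \<and> inj_on (h \<circ> \<sigma>) {1..n}}"
  have "sampled_average n M V P h \<le>
      (\<Sum>\<sigma> | \<sigma> permutes {1..V}. lo + (if inj_on (h \<circ> \<sigma>) {1..n} then 1 else 0)) / fact V"
  proof (rule sampled_average_le)
    fix \<sigma> \<pi> assume \<sigma>: "\<sigma> permutes {1..V}" and \<pi>: "\<pi> permutes {1..M}"
    have fs: "sample n M (h \<circ> \<sigma>) \<pi> \<in> function_space n M" by (rule sample_in_function_space[OF nM \<pi>])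
    have "inj_on (sample n M (h \<circ> \<sigma>) \<pi>) {1..n} \<longleftrightarrow> inj_on (h \<circ> \<sigma>) {1..n}"
      by (rule inj_on_sample_iff[OF nM \<pi>])
    then show "P (sample n M (h \<circ> \<sigma>) \<pi>) \<le> lo + (if inj_on (h \<circ> \<sigma>) {1..n} then 1 else 0)"
      using lo(1)[OF fs] lo(2) P1[OF fs] by auto
  qed
  also have "(\<Sum>\<sigma> | \<sigma> permutes {1..V}. lo + (if inj_on (h \<circ> \<sigma>) {1..n} then 1 else 0)) = fact V * lo + real (card Q)"
  proof -
    have "(\<Sum>\<sigma> | \<sigma> permutes {1..V}. if inj_on (h \<circ> \<sigma>) {1..n} then 1 else (0::real)) = (\<Sum>\<sigma>\<in>Q. 1)"
      unfolding Q_def by (rule sum.mono_neutral_cong_right) (auto simp: finite_permutations)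
    then show ?thesis using card_permutations[of "{1..V}" V] by (simp add: sum.distrib)
  qed
  also have "(fact V * lo + real (card Q)) / fact V = lo + real (card Q) / fact V"
    by (simp add: add_divide_distrib)
  also have "real (card Q) / fact V \<le> exp (- (real n * (real n - 1) / (2 * V)))"
    unfolding Q_def by (rule collision_free_fraction[OF two nV])
  finally show ?thesis by simp
qed

section \<open>Query bounds for the two properties\<close>

text \<open>With V = N every point is used, so samples of one-to-one and two-to-one colourings keep
  that property and lie where \<open>collision\<close> is defined.\<close>

lemma collision_query_bound:
  fixes c N M :: nat and \<epsilon> \<delta> :: real
  assumes A: "valid_algorithm N M A" "computes N M A (collision N M) \<epsilon>"
    and N: "even N" "4 \<le> N" "N \<le> M"
    and gap: "2 * \<delta> \<le> 1 - \<epsilon> - \<epsilon>" "0 < \<delta>" and c: "144 < \<delta> * c" "2 \<le> c"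
  shows "N < 16 * (2 + c) * (2 * queries A) ^ 3"
proof -
  define P where "P f = output_prob N M A f True" for f
  obtain F where F: "query_poly N M (2 * queries A) F" "\<And>f. f \<in> function_space N M \<Longrightarrow> F f = of_real (P f)"
    unfolding P_def using output_prob_query_poly by blast
  show ?thesis
  proof (rule degree_bound_of_average_gap[OF F _ N(3) order_refl N(1,2) _ _ gap c])
    show "0 \<le> P f \<and> P f \<le> 1" if "f \<in> function_space N M" for f
      using output_prob_total[OF A(1) that] output_prob_nonneg[of N M A f] unfolding P_def by (smt (verit))
  next
    fix h :: "nat \<Rightarrow> nat" assume h: "inj_on h {1..N}"
    show "1 - \<epsilon> \<le> sampled_average N M N P h"
    proof (rule sampled_average_ge)
      fix \<sigma> \<pi> assume \<sigma>: "\<sigma> permutes {1..N}" and \<pi>: "\<pi> permutes {1..M}"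
      have "inj_on (h \<circ> \<sigma>) {1..N}" 
        using comp_inj_on[OF permutes_inj_on[OF \<sigma>]] h permutes_image[OF \<sigma>] by metis
      then have "inj_on (sample N M (h \<circ> \<sigma>) \<pi>) {1..N}"
        by (simp only: inj_on_sample_iff[OF N(3) \<pi>])
      then have "collision N M (sample N M (h \<circ> \<sigma>) \<pi>) = Some True" by (simp add: collision_def)
      then show "1 - \<epsilon> \<le> P (sample N M (h \<circ> \<sigma>) \<pi>)"
        using A(2) sample_in_function_space[OF N(3) \<pi>] unfolding computes_def P_def by blast
    qed
  next
    fix h :: "nat \<Rightarrow> nat" assume h: "\<And>x. x \<in> {1..N} \<Longrightarrow> card {y \<in> {1..N}. h y = h x} = 2"
    have "sampled_average N M N P h \<le> (\<Sum>\<sigma> | \<sigma> permutes {1..N}. \<epsilon>) / fact N"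
    proof (rule sampled_average_le)
      fix \<sigma> \<pi> assume \<sigma>: "\<sigma> permutes {1..N}" and \<pi>: "\<pi> permutes {1..M}"
      define f where "f = sample N M (h \<circ> \<sigma>) \<pi>"
      have fs: "f \<in> function_space N M" unfolding f_def by (rule sample_in_function_space[OF N(3) \<pi>])
      have cls: "card {y \<in> {1..N}. f y = f x} = 2" if x: "x \<in> {1..N}" for x
      proof -
        have \<sigma>x: "\<sigma> x \<in> {1..N}" using permutes_in_image[OF \<sigma>] x by blast
        have "card {y \<in> {1..N}. f y = f x} = card {y \<in> {1..N}. h (\<sigma> y) = h (\<sigma> x)}"
          using sample_eq_iff[OF N(3) \<pi> _ x, of _ "h \<circ> \<sigma>"] unfolding f_def
          by (intro arg_cong[of _ _ card] Collect_cong conj_cong refl) simp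
        also have "\<dots> = card (\<sigma> ` {y \<in> {1..N}. h (\<sigma> y) = h (\<sigma> x)})"
          by (rule card_image[symmetric]) (rule permutes_inj_on[OF \<sigma>])
        also have "{y \<in> {1..N}. h (\<sigma> y) = h (\<sigma> x)} = \<sigma> -` {y \<in> {1..N}. h y = h (\<sigma> x)}"
          unfolding vimage_def by (simp only: mem_Collect_eq permutes_in_image[OF \<sigma>])
        also have "\<sigma> ` \<dots> = {y \<in> {1..N}. h y = h (\<sigma> x)}"
          by (rule surj_image_vimage_eq[OF permutes_surj[OF \<sigma>]])
        also have "card \<dots> = 2" by (rule h[OF \<sigma>x])
        finally show ?thesis .
      qed
      \<comment> \<open>\<open>collision\<close> tests for one-to-one first, so that case is
        excluded before the value \<open>False\<close> is obtained.\<close>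
      have "\<not> inj_on f {1..N}"
      proof
        assume inj: "inj_on f {1..N}"
        have "y = 1" if "y \<in> {1..N}" "f y = f 1" for y using inj_onD[OF inj that(2,1)] N(2) by simp
        then have "{y \<in> {1..N}. f y = f 1} \<subseteq> {1}" by blast
        then have "card {y \<in> {1..N}. f y = f 1} \<le> card {1::nat}" by (intro card_mono) auto
        then show False using cls[of 1] N(2) by simp
      qed
      moreover have "\<forall>k\<in>{1..M}. card {x \<in> {1..N}. f x = k} \<in> {0, 2}"
      proof
        fix k
        show "card {x \<in> {1..N}. f x = k} \<in> {0, 2}"
        proof (cases "\<exists>x\<in>{1..N}. f x = k")
          case True
          then obtain x where x: "x \<in> {1..N}" "k = f x" by blast
          show ?thesis unfolding x(2) cls[OF x(1)] by simp
        next
          case False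
          then have "{x \<in> {1..N}. f x = k} = {}" by blast
          then show ?thesis by (simp only: card.empty) simp
        qed
      qed
      ultimately have "collision N M f = Some False" by (simp add: collision_def)
      then have "1 - \<epsilon> \<le> output_prob N M A f False" using A(2) fs unfolding computes_def by blast
      then show "P (sample N M (h \<circ> \<sigma>) \<pi>) \<le> \<epsilon>"
        using output_prob_total[OF A(1) fs] unfolding P_def f_def by linarith
    qed
    then show "sampled_average N M N P h \<le> \<epsilon>" using card_permutations[of "{1..N}" N] by simp
  qed
qed

text \<open>\<open>V\<close> stays free: a larger one strengthens the conclusion but makes a
  collision among \<open>N\<close> points rarer, which is the cost of the exponential term.\<close>

lemma element_distinctness_query_bound:
  fixes c N M V :: nat and \<epsilon> \<delta> :: real
  assumes A: "valid_algorithm N M A" "computes N M A (element_distinctness N) \<epsilon>"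
    and N: "N \<le> M" "2 * N \<le> V" "even V" "4 \<le> V" and \<epsilon>: "0 \<le> \<epsilon>"
    and gap: "2 * \<delta> \<le> 1 - \<epsilon> - (\<epsilon> + exp (- (real N * (real N - 1) / (2 * V))))" "0 < \<delta>"
    and c: "144 < \<delta> * c" "2 \<le> c"
  shows "V < 16 * (2 + c) * (2 * queries A) ^ 3"
proof -
  define P where "P f = output_prob N M A f True" for f
  obtain F where F: "query_poly N M (2 * queries A) F" "\<And>f. f \<in> function_space N M \<Longrightarrow> F f = of_real (P f)"
    unfolding P_def using output_prob_query_poly by blast
  have P01: "0 \<le> P f \<and> P f \<le> 1" if "f \<in> function_space N M" for f
    using output_prob_total[OF A(1) that] output_prob_nonneg[of N M A f] unfolding P_def by (smt (verit))
  have distinct: "element_distinctness N f = Some (inj_on f {1..N})" for f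
    unfolding element_distinctness_def inj_on_def by auto
  have NV: "N \<le> V" using N by simp
  show ?thesis
  proof (rule degree_bound_of_average_gap[OF F P01 N(1) NV N(3,4) _ _ gap c])
    fix h :: "nat \<Rightarrow> nat" assume h: "inj_on h {1..V}"
    show "1 - \<epsilon> \<le> sampled_average N M V P h"
    proof (rule sampled_average_ge)
      fix \<sigma> \<pi> assume \<sigma>: "\<sigma> permutes {1..V}" and \<pi>: "\<pi> permutes {1..M}"
      have "inj_on (h \<circ> \<sigma>) {1..V}" 
        using comp_inj_on[OF permutes_inj_on[OF \<sigma>]] h permutes_image[OF \<sigma>] by metis
      then have "inj_on (h \<circ> \<sigma>) {1..N}" by (rule inj_on_subset) (use NV in auto)
      then have "inj_on (sample N M (h \<circ> \<sigma>) \<pi>) {1..N}"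
        by (simp only: inj_on_sample_iff[OF N(1) \<pi>])
      then have "element_distinctness N (sample N M (h \<circ> \<sigma>) \<pi>) = Some True" by (simp only: distinct)
      then show "1 - \<epsilon> \<le> P (sample N M (h \<circ> \<sigma>) \<pi>)"
        using A(2) sample_in_function_space[OF N(1) \<pi>] unfolding computes_def P_def by blast
    qed
  next
    fix h :: "nat \<Rightarrow> nat" assume h: "\<And>x. x \<in> {1..V} \<Longrightarrow> card {y \<in> {1..V}. h y = h x} = 2"
    show "sampled_average N M V P h \<le> \<epsilon> + exp (- (real N * (real N - 1) / (2 * V)))"
    proof (rule sampled_average_two_to_one_le[OF N(1) _ _ \<epsilon> h N(2)])
      fix f assume f: "f \<in> function_space N M"
      show "P f \<le> 1" using P01[OF f] by simp
      assume "\<not> inj_on f {1..N}"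
      then have "element_distinctness N f = Some False" by (simp add: distinct)
      then have "1 - \<epsilon> \<le> output_prob N M A f False" using A(2) f unfolding computes_def by blast
      then show "P f \<le> \<epsilon>" using output_prob_total[OF A(1) f] unfolding P_def by linarith
    qed (use N in auto)
  qed
qed

lemma powr_one_third_le:
  assumes "0 \<le> x" "x \<le> real t ^ 3"
  shows "x powr (1/3) \<le> real t"
proof (cases "t = 0")
  case False
  have "x powr (1/3) \<le> (real t ^ 3) powr (1/3)" using assms by (intro powr_mono2) auto
  also have "real t ^ 3 = real t powr 3" using False by simp
  also have "(real t powr 3) powr (1/3) = real t" unfolding powr_powr by simp
  finally show ?thesis .
qed (use assms in simp)

theorem mainTheorem2:
  fixes \<epsilon> :: real
  assumes "0 < \<epsilon>" and "\<epsilon> < 1/2"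
  shows "\<exists>c>0. \<forall>\<^sub>F N in sequentially. \<forall>M\<ge>N.
    (even N \<longrightarrow>
      (\<forall>A. valid_algorithm N M A \<and> computes N M A (collision N M) \<epsilon> \<longrightarrow>
        real (queries A) \<ge> c * real N powr (1/3))) \<and>
    (\<forall>A. valid_algorithm N M A \<and> computes N M A (element_distinctness N) \<epsilon> \<longrightarrow>
        real (queries A) \<ge> c * real N powr (2/3))"
proof -
  \<comment> \<open>The total gap is 4\<delta>: half may be lost to the birthday term, leaving the
    2\<delta> that the gap argument requires.\<close>
  define \<delta> where "\<delta> = (1 - 2 * \<epsilon>) / 4"
  have \<delta>: "0 < \<delta>" "4 * \<delta> = 1 - 2 * \<epsilon>" using assms by (simp_all add: \<delta>_def)
  obtain c0 :: nat where c0: "144 / \<delta> < c0" using reals_Archimedean2 by blast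
  define c where "c = c0 + 2"
  have c: "144 < \<delta> * c" "2 \<le> c"
  proof -
    have "144 / \<delta> < c" using c0 by (simp add: c_def)
    then show "144 < \<delta> * c" using \<delta> by (simp add: field_simps)
  qed (simp add: c_def)
  \<comment> \<open>\<open>V\<close> will be about N^2/C, so that the birthday exponent is at least
    C/4; \<open>C\<close> makes the exponential at most 2\<delta>.\<close>
  obtain C0 :: nat where C0: "- 4 * ln (2 * \<delta>) < C0" using reals_Archimedean2 by blast
  define C where "C = Suc C0"
  have C: "exp (- real C / 4) \<le> 2 * \<delta>" "1 \<le> C"
  proof -
    have "- real C / 4 \<le> ln (2 * \<delta>)" using C0 by (simp add: C_def)
    then have "exp (- real C / 4) \<le> exp (ln (2 * \<delta>))" by (simp only: exp_le_cancel_iff)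
    then show "exp (- real C / 4) \<le> 2 * \<delta>" using \<delta> by simp
  qed (simp add: C_def)
  \<comment> \<open>128 = 16 * 2^3, since the degree is twice the number of queries.\<close>
  define D where "D = 128 * (2 + c)"
  \<comment> \<open>Fitted to the weaker of the two estimates, N^2 <= 2 C D T^3, and then valid for
    the collision bound too.\<close>
  define K where "K = (1 / real (2 * C * D)) powr (1/3)"
  have D: "16 * (2 + c) * (2 * t) ^ 3 = D * t ^ 3" for t :: nat
    by (simp add: D_def power_mult_distrib)
  have pos: "0 < real (2 * C * D)" using C by (simp add: D_def)
  have bound: "K * x powr (1/3) \<le> real t" if "0 \<le> x" "x \<le> real (2 * C * D) * real t ^ 3" for x t
  proof -
    have "K * x powr (1/3) = (1 / real (2 * C * D) * x) powr (1/3)"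
      unfolding K_def using that(1) by (subst powr_mult) auto
    also have "\<dots> \<le> real t"
      using that pos by (intro powr_one_third_le) (simp_all add: pos_divide_le_eq mult.commute)
    finally show ?thesis .
  qed
  have main: "(even N \<longrightarrow>
      (\<forall>A. valid_algorithm N M A \<and> computes N M A (collision N M) \<epsilon> \<longrightarrow>
        real (queries A) \<ge> K * real N powr (1/3))) \<and>
    (\<forall>A. valid_algorithm N M A \<and> computes N M A (element_distinctness N) \<epsilon> \<longrightarrow>
        real (queries A) \<ge> K * real N powr (2/3))"
    if N: "8 * C \<le> N" and M: "N \<le> M" for N M
  proof (intro conjI impI allI; elim conjE)
    fix A assume "even N" and A: "valid_algorithm N M A" "computes N M A (collision N M) \<epsilon>"
    have "N < D * queries A ^ 3"
      using collision_query_bound[OF A \<open>even N\<close> _ M, of \<delta> c] N C \<delta> c unfolding D by simp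
    also have "\<dots> \<le> 2 * C * D * queries A ^ 3" using C by simp
    finally have "real N \<le> real (2 * C * D * queries A ^ 3)" by (simp only: of_nat_le_iff less_imp_le)
    then show "K * real N powr (1/3) \<le> real (queries A)" by (intro bound) simp_all
  next
    fix A assume A: "valid_algorithm N M A" "computes N M A (element_distinctness N) \<epsilon>"
    \<comment> \<open>The number of points is V = 4q, an even number close to N^2/C.\<close>
    define q where "q = N\<^sup>2 div (4 * C)"
    have q: "4 * C * q \<le> N\<^sup>2" "N\<^sup>2 < 4 * C * q + 4 * C"
    proof -
      show "4 * C * q \<le> N\<^sup>2" unfolding q_def by simp
      show "N\<^sup>2 < 4 * C * q + 4 * C"
        using mult_div_mod_eq[of "4 * C" "N\<^sup>2"] mod_less_divisor[of "4 * C" "N\<^sup>2"] C unfolding q_def by linarith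
    qed
    have N2: "8 * C * N \<le> N\<^sup>2" using N by (simp add: power2_eq_square)
    have "8 * C * 1 \<le> 8 * C * N" using N C by (intro mult_left_mono) auto
    \<comment> \<open>For N >= 8C the rounding loses at most a factor 2.\<close>
    then have half: "N\<^sup>2 \<le> 2 * C * (4 * q)" using q N2 by linarith
    have "8 * C * N \<le> 8 * C * q" using half N2 by linarith
    then have Nq: "N \<le> q" using C by simp
    have "exp (- (real N * (real N - 1) / (2 * real (4 * q)))) \<le> exp (- real C / 4)"
    proof -
      have "real (4 * C * q) \<le> real (N\<^sup>2)" using q(1) by (simp only: of_nat_le_iff)
      \<comment> \<open>This gives N(N-1) >= N^2/2, and with N^2 >= 4 C q the exponent is at least
        C/4.\<close>
      moreover have "real N * 2 \<le> real N * real N" using N C by (intro mult_left_mono) auto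
      ultimately have "real C * (2 * real (4 * q)) \<le> 4 * (real N * (real N - 1))"
        by (simp add: power2_eq_square algebra_simps)
      moreover have "0 < 2 * real (4 * q)" using Nq N C by simp
      ultimately have "real C / 4 \<le> real N * (real N - 1) / (2 * real (4 * q))"
        by (simp only: pos_le_divide_eq)
      then show ?thesis by simp
    qed
    then have "2 * \<delta> \<le> 1 - \<epsilon> - (\<epsilon> + exp (- (real N * (real N - 1) / (2 * real (4 * q)))))"
      using C(1) \<delta>(2) by linarith
    then have "4 * q < D * queries A ^ 3"
      using element_distinctness_query_bound[OF A M, of "4 * q" \<delta> c] Nq N C \<delta> c assms unfolding D by simp
    then have "2 * C * (4 * q) \<le> 2 * C * (D * queries A ^ 3)" by (intro mult_left_mono) auto
    with half have "N\<^sup>2 \<le> 2 * C * (D * queries A ^ 3)" by (rule order_trans)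
    then have "real (N\<^sup>2) \<le> real (2 * C * D * queries A ^ 3)" by (simp only: of_nat_le_iff mult.assoc)
    then have "K * (real N ^ 2) powr (1/3) \<le> real (queries A)" by (intro bound) simp_all
    moreover have "(real N ^ 2) powr (1/3) = real N powr (2/3)"
    proof -
      have "real N ^ 2 = real N powr 2" using N C by simp
      then show ?thesis by (simp only: powr_powr) simp
    qed
    ultimately show "K * real N powr (2/3) \<le> real (queries A)" by simp
  qed
  have "K > 0" using C by (simp add: K_def D_def)
  moreover have "\<forall>\<^sub>F N in sequentially. 8 * C \<le> N" by (rule eventually_ge_at_top)
  then have "\<forall>\<^sub>F N in sequentially. \<forall>M\<ge>N.
    (even N \<longrightarrow>
      (\<forall>A. valid_algorithm N M A \<and> computes N M A (collision N M) \<epsilon> \<longrightarrow>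
        real (queries A) \<ge> K * real N powr (1/3))) \<and>
    (\<forall>A. valid_algorithm N M A \<and> computes N M A (element_distinctness N) \<epsilon> \<longrightarrow>
        real (queries A) \<ge> K * real N powr (2/3))"
    by (rule eventually_mono) (intro allI impI, rule main)
  ultimately show ?thesis by blast
qed

end
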